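(* Let $\lambda$ be an infinite cardinal. Then over every field of cardinality $\lambda$ there exists a $\lambda^+$-Gross space of dimension $\lambda^{++}$.
   Context: For an infinite cardinal $\mu$, a $\mu$-Gross space over a field $F$ is an $F$-vector space $E$ with a symmetric bilinear form $\Phi:E\times E\to F$ such that every subspace $U\subseteq E$ with $\dim U\ge\mu$ satisfies $\dim U^\perp<\dim E$, where $U^\perp=\{x\in E:\Phi(x,y)=0\ \forall y\in U\}$. $\lambda^+$ and $\lambda^{++}$ are the successor and double successor cardinals of $\lambda$. *)

theory Defs
  imports "Jordan_Normal_Form.Missing_VectorSpace"
begin

unbundle cardinal_syntax

text \<open>
  The dimension of a possibly infinite-dimensional space, as a cardinal. (The constant
  \<open>vectorspace.dim\<close> is a natural number and only meaningful in finite dimension.) Every vector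
  space has a basis and any two bases are equipotent, so the choice of the basis is immaterial.
\<close>

definition (in vectorspace) cdim :: "'c rel" where
  "cdim = |SOME B. basis B|"

locale symmetric_bilinear_space = vectorspace K V
  for K :: "('a, 'm) ring_scheme" and V :: "('a, 'c, 'n) module_scheme" +
  fixes \<Phi> :: "'c \<Rightarrow> 'c \<Rightarrow> 'a"
  assumes form_closed:
      "\<lbrakk>x \<in> carrier V; y \<in> carrier V\<rbrakk> \<Longrightarrow> \<Phi> x y \<in> carrier K"
    and form_add_left:
      "\<lbrakk>x \<in> carrier V; y \<in> carrier V; z \<in> carrier V\<rbrakk>
        \<Longrightarrow> \<Phi> (x \<oplus>\<^bsub>V\<^esub> y) z = \<Phi> x z \<oplus>\<^bsub>K\<^esub> \<Phi> y z"
    and form_add_right: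
      "\<lbrakk>x \<in> carrier V; y \<in> carrier V; z \<in> carrier V\<rbrakk>
        \<Longrightarrow> \<Phi> x (y \<oplus>\<^bsub>V\<^esub> z) = \<Phi> x y \<oplus>\<^bsub>K\<^esub> \<Phi> x z"
    and form_smult_left:
      "\<lbrakk>c \<in> carrier K; x \<in> carrier V; y \<in> carrier V\<rbrakk>
        \<Longrightarrow> \<Phi> (c \<odot>\<^bsub>V\<^esub> x) y = c \<otimes>\<^bsub>K\<^esub> \<Phi> x y"
    and form_smult_right:
      "\<lbrakk>c \<in> carrier K; x \<in> carrier V; y \<in> carrier V\<rbrakk>
        \<Longrightarrow> \<Phi> x (c \<odot>\<^bsub>V\<^esub> y) = c \<otimes>\<^bsub>K\<^esub> \<Phi> x y"
    and form_sym:
      "\<lbrakk>x \<in> carrier V; y \<in> carrier V\<rbrakk> \<Longrightarrow> \<Phi> x y = \<Phi> y x"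
begin

definition orth :: "'c set \<Rightarrow> 'c set" where
  "orth U = {x \<in> carrier V. \<forall>y\<in>U. \<Phi> x y = \<zero>\<^bsub>K\<^esub>}"

end

locale gross_space = symmetric_bilinear_space K V \<Phi>
  for \<mu> :: "'b rel" and K :: "('a, 'm) ring_scheme"
    and V :: "('a, 'c, 'n) module_scheme" and \<Phi> :: "'c \<Rightarrow> 'c \<Rightarrow> 'a" +
  assumes infinite_cardinal: "Cinfinite \<mu>"
    and gross:
      "\<lbrakk>subspace K U V; \<mu> \<le>o vectorspace.cdim K (vs U)\<rbrakk>
        \<Longrightarrow> vectorspace.cdim K (vs (orth U)) <o cdim"

end

theory Submission
  imports Defs "HOL-Algebra.Free_Abelian_Groups"
begin

text \<open>
  Write \<open>\<lambda>\<close> for the size of the field. Let \<open>E\<close> have a basis indexed by \<open>\<lambda>\<^sup>+\<^sup>+\<close>, and let the form be given by a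
  symmetric matrix \<open>c\<close>. Any additive group of more than \<open>\<mu> \<ge> \<lambda>\<close> vectors contains more than \<open>\<mu>\<close>
  vectors with pairwise disjoint supports and the same finite set of coefficients. Hence it is enough
  that \<open>c\<close> does not vanish identically between a disjoint family of \<open>\<lambda>\<^sup>+\<close> vectors and a later disjoint
  family of \<open>\<lambda>\<^sup>+\<^sup>+\<close> vectors with finitely many coefficients each.

  Two cases are distinguished, according to whether every family of \<open>\<lambda>\<^sup>+\<^sup>+\<close> functions
  \<open>\<lambda>\<^sup>+ \<rightarrow> \<lambda>\<^sup>+\<close> is eventually dominated by a single function.

  If not, a well-ordered unbounded chain of functions splits every \<open>b < \<lambda>\<^sup>+\<^sup>+\<close> into \<open>\<lambda>\<^sup>+\<close> blocks of size
  at most \<open>\<lambda>\<close>, and the column \<open>c(-, b)\<close> is chosen by recursion on \<open>b\<close>, on each block generic over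
  \<open>\<lambda>\<close> many earlier columns. Unboundedness yields a \<open>b\<close> at the top of the support of a vector of the
  second family one of whose blocks contains \<open>\<lambda>\<close> vectors of the first.

  If so, the enumerations \<open>b \<rightarrow> \<lambda>\<^sup>+\<close> all agree modulo a single club, so that collapsing the initial
  parts which they enumerate gives each pair \<open>a < b\<close> a stage \<open>z < \<lambda>\<^sup>+\<close>, a label of \<open>a\<close> in \<open>\<lambda>\<^sup>+\<close>, and a
  label of \<open>b\<close> in \<open>\<lambda>\<close>, coherently in \<open>b\<close>. Feeding these labels into eventually different functions
  \<open>\<lambda> \<rightarrow> \<lambda>\<close> and a generic function \<open>\<lambda> \<times> \<lambda> \<rightarrow> F\<close> gives the matrix.
\<close>

section \<open>Cardinal arithmetic\<close>

lemma finite_ordLess_Cinfinite: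
  assumes "Cinfinite r" "finite A"
  shows "|A| <o r"
proof -
  have "|A| <o natLeq" using assms(2) finite_iff_ordLess_natLeq by auto
  then show ?thesis using natLeq_ordLeq_cinfinite[OF assms(1)] by (rule ordLess_ordLeq_trans)
qed

lemma ordLeq_image: "|A| \<le>o r \<Longrightarrow> |f ` A| \<le>o r"
  using card_of_image ordLeq_transitive by blast

lemma ordLess_image: "|A| <o r \<Longrightarrow> |f ` A| <o r"
  using card_of_image ordLeq_ordLess_trans by blast

lemma ordLeq_subset: "|A| \<le>o r \<Longrightarrow> B \<subseteq> A \<Longrightarrow> |B| \<le>o r"
  using card_of_mono1 ordLeq_transitive by blast

lemma ordLess_subset: "|A| <o r \<Longrightarrow> B \<subseteq> A \<Longrightarrow> |B| <o r"
  using card_of_mono1 ordLeq_ordLess_trans by blast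

lemma ordLeq_Un:
  assumes "Cinfinite r" "|A| \<le>o r" "|B| \<le>o r"
  shows "|A \<union> B| \<le>o r"
  using assms card_of_Un_ordLeq_infinite_Field unfolding cinfinite_def by blast

lemma ordLeq_UN:
  assumes "Cinfinite r" "|I| \<le>o r" "\<And>i. i \<in> I \<Longrightarrow> |A i| \<le>o r"
  shows "|\<Union>i\<in>I. A i| \<le>o r"
  using assms card_of_UNION_ordLeq_infinite_Field unfolding cinfinite_def by blast

lemma ordLeq_Times:
  assumes "Cinfinite r" "|A| \<le>o r" "|B| \<le>o r"
  shows "|A \<times> B| \<le>o r"
  using assms card_of_Times_ordLeq_infinite_Field unfolding cinfinite_def by blast

lemma ordLeq_Fpow:
  assumes r: "Cinfinite r" and A: "|A| \<le>o r"
  shows "|Fpow A| \<le>o r"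
proof (cases "finite A")
  case True
  then have "finite (Fpow A)" by (simp add: Fpow_def)
  then show ?thesis by (rule ordLess_imp_ordLeq[OF finite_ordLess_Cinfinite[OF r]])
next
  case False
  then show ?thesis using card_of_Fpow_infinite A ordIso_ordLeq_trans by blast
qed

lemma ordLess_Un:
  assumes "Cinfinite r" "|A| <o r" "|B| <o r"
  shows "|A \<union> B| <o r"
  using assms card_of_Un_ordLess_infinite_Field unfolding cinfinite_def by blast

text \<open>Restricted to finite index sets because \<open>r\<close> may be singular: a union of
  fewer than \<open>r\<close> sets, each smaller than \<open>r\<close>, can then have size
  \<open>r\<close>.\<close>

lemma ordLess_UN_finite:
  assumes "Cinfinite r" "finite I" "\<And>i. i \<in> I \<Longrightarrow> |A i| <o r"
  shows "|\<Union>i\<in>I. A i| <o r"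
  using assms(2,3)
proof (induction I)
  case empty
  then show ?case using finite_ordLess_Cinfinite[OF assms(1), of "{}"] by simp
next
  case (insert x F)
  then have "|A x \<union> \<Union> (A ` F)| <o r" by (intro ordLess_Un[OF assms(1)]) auto
  then show ?case by simp
qed

lemma ordLess_Fpow:
  assumes r: "Cinfinite r" and A: "|A| <o r"
  shows "|Fpow A| <o r"
proof (cases "finite A")
  case True
  then have "finite (Fpow A)" by (simp add: Fpow_def)
  then show ?thesis using finite_ordLess_Cinfinite[OF r] by blast
next
  case False
  then show ?thesis using card_of_Fpow_infinite A ordIso_ordLess_trans by blast
qed

lemma ordLess_Times:
  assumes r: "Cinfinite r" and A: "|A| <o r" and B: "|B| <o r"
  shows "|A \<times> B| <o r"
proof (cases "finite (A <+> B)")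
  case True
  then have "finite (A \<times> B)" by simp
  then show ?thesis using finite_ordLess_Cinfinite[OF r] by blast
next
  case False
  have AB: "|A <+> B| <o r"
    using card_of_Plus_ordLess_infinite_Field assms unfolding cinfinite_def by blast
  have "|A \<times> B| \<le>o |A <+> B|"
    using card_of_Times_ordLeq_infinite_Field[of "|A <+> B|" A B] False
      card_of_Plus1 card_of_Plus2 card_of_Card_order by (simp add: Field_card_of)
  then show ?thesis using AB ordLeq_ordLess_trans by blast
qed

lemma ordLess_cardSuc_iff: "Card_order r \<Longrightarrow> |A| <o cardSuc r \<longleftrightarrow> |A| \<le>o r"
  by (rule cardSuc_ordLeq_ordLess[OF _ card_of_Card_order])

lemma cardSuc_ordLeq_iff: "Card_order r \<Longrightarrow> cardSuc r \<le>o |A| \<longleftrightarrow> \<not> |A| \<le>o r"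
  using cardSuc_ordLess_ordLeq[of r "|A|"] not_ordLeq_iff_ordLess[of "|A|" r] card_of_Well_order[of A]
  by (simp add: card_of_Card_order)

lemma exists_subset_ordIso:
  assumes "Card_order r" "r \<le>o |A|"
  shows "\<exists>B\<subseteq>A. |B| =o r"
proof -
  have "|Field r| \<le>o |A|"
    using card_of_Field_ordIso[OF assms(1)] assms(2) by (rule ordIso_ordLeq_trans)
  then obtain f where f: "inj_on f (Field r)" "f ` Field r \<subseteq> A"
    using card_of_ordLeq[of "Field r" A] by auto
  have "|f ` Field r| =o |Field r|"
    by (rule ordIso_symmetric[OF card_of_ordIsoI[OF inj_on_imp_bij_betw[OF f(1)]]])
  then have "|f ` Field r| =o r"
    using card_of_Field_ordIso[OF assms(1)] by (rule ordIso_transitive)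
  then show ?thesis using f(2) by blast
qed

lemma exists_inj_Field:
  assumes "Card_order r" "|A| \<le>o r"
  shows "\<exists>f. inj_on f A \<and> f ` A \<subseteq> Field r"
proof -
  have "|A| \<le>o |Field r|"
    using assms(2) ordIso_symmetric[OF card_of_Field_ordIso[OF assms(1)]]
    by (rule ordLeq_ordIso_trans)
  then show ?thesis using card_of_ordLeq[of A "Field r"] by simp
qed

lemma not_ordLeq_Diff:
  assumes "Cinfinite r" "\<not> |A| \<le>o r" "|B| \<le>o r"
  shows "\<not> |A - B| \<le>o r"
proof
  assume "|A - B| \<le>o r"
  then have "|(A - B) \<union> B| \<le>o r" using ordLeq_Un assms by blast
  then show False using ordLeq_subset[of "(A - B) \<union> B" r A] assms(2) by blast
qed

text \<open>By disjointness, choosing for each such \<open>u\<close> a point of \<open>S u\<close>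
  in \<open>A\<close> is injective.\<close>

lemma card_of_hitting:
  assumes "\<And>u v. u \<in> X \<Longrightarrow> v \<in> X \<Longrightarrow> u \<noteq> v \<Longrightarrow> S u \<inter> S v = {}"
  shows "|{u \<in> X. S u \<inter> A \<noteq> {}}| \<le>o |A|"
proof -
  define f where "f u = (SOME a. a \<in> S u \<inter> A)" for u
  have f: "f u \<in> S u \<inter> A" if "u \<in> {u \<in> X. S u \<inter> A \<noteq> {}}" for u
    using that unfolding f_def by (intro someI_ex[of "\<lambda>a. a \<in> S u \<inter> A"]) auto
  have "inj_on f {u \<in> X. S u \<inter> A \<noteq> {}}"
  proof (rule inj_onI, rule ccontr)
    fix u v
    assume u: "u \<in> {u \<in> X. S u \<inter> A \<noteq> {}}" and v: "v \<in> {u \<in> X. S u \<inter> A \<noteq> {}}"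
      and "f u = f v" "u \<noteq> v"
    then show False using f[OF u] f[OF v] assms[of u v] by auto
  qed
  then show ?thesis
    using f card_of_ordLeq[of "{u \<in> X. S u \<inter> A \<noteq> {}}" A] by blast
qed

section \<open>Initial segments of well-orders\<close>

lemma underS_trans:
  assumes "Well_order r" "x \<in> underS r y" "y \<in> underS r z"
  shows "x \<in> underS r z"
proof -
  have "wo_rel r" using assms(1) by (simp add: wo_rel_def)
  then have "trans r" "antisym r" by (rule wo_rel.TRANS, rule wo_rel.ANTISYM)
  then show ?thesis
    using assms(2,3) unfolding underS_def by (auto dest: transD antisymD)
qed

lemma underS_linear:
  assumes "Well_order r" "x \<in> Field r" "y \<in> Field r"
  shows "x \<in> underS r y \<or> x = y \<or> y \<in> underS r x"
proof -
  have "wo_rel r" using assms(1) by (simp add: wo_rel_def)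
  then have "Total r" by (rule wo_rel.TOTAL)
  then show ?thesis
    using assms(2,3) unfolding underS_def total_on_def by auto
qed

lemma underS_in_Field: "x \<in> underS r y \<Longrightarrow> x \<in> Field r \<and> y \<in> Field r"
  unfolding underS_def Field_def by auto

text \<open>Weak inequality x \<le> y is written as \<open>y \<notin> underS r x\<close>, which is
  faithful on the field because the order is total. This is the chain x \<le> y < z;
  \<open>underS_le_trans\<close> is x < y \<le> z.\<close>

lemma underS_not_le_trans:
  assumes "Well_order r" "x \<in> Field r" "y \<in> underS r z" "y \<notin> underS r x"
  shows "x \<in> underS r z"
  using underS_linear[OF assms(1,2), of y] underS_trans[OF assms(1) _ assms(3), of x]
    underS_in_Field[OF assms(3)] assms(3,4) by auto

lemma underS_le_trans:
  assumes "Well_order r" "x \<in> underS r y" "z \<in> Field r" "z \<notin> underS r y"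
  shows "x \<in> underS r z"
  using underS_linear[OF assms(1,3), of y] underS_trans[OF assms(1,2), of z]
    underS_in_Field[OF assms(2)] assms(2,4) by auto

lemma wf_underS:
  assumes "Well_order r"
  shows "wf {(x, y). x \<in> underS r y}"
proof -
  have "{(x, y). x \<in> underS r y} = r - Id"
    unfolding underS_def by auto
  then show ?thesis using assms by (simp add: well_order_on_def)
qed

lemma underS_least:
  assumes "Well_order r" "P x"
  shows "\<exists>m. P m \<and> (\<forall>y\<in>underS r m. \<not> P y)"
  using wf_underS[OF assms(1)] assms(2) unfolding wf_eq_minimal by (auto dest!: spec[of _ "Collect P"])

lemma underS_finite_max:
  assumes "Well_order r" "finite S" "S \<noteq> {}" "S \<subseteq> Field r"
  shows "\<exists>m\<in>S. \<forall>x\<in>S - {m}. x \<in> underS r m"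
  using assms(2-4)
proof (induction S rule: finite_ne_induct)
  case (singleton x)
  then show ?case by auto
next
  case (insert x F)
  then obtain m where m: "m \<in> F" "\<forall>y\<in>F - {m}. y \<in> underS r m" by auto
  have "x \<in> underS r m \<or> m \<in> underS r x"
    using underS_linear[OF assms(1)] insert m by blast
  then show ?case
  proof
    assume "x \<in> underS r m"
    then show ?thesis using m by auto
  next
    assume *: "m \<in> underS r x"
    then have "\<forall>y\<in>F. y \<in> underS r x" using m underS_trans[OF assms(1)] by blast
    then show ?thesis by auto
  qed
qed

text \<open>Regularity of successor cardinals: if \<open>A\<close> had no strict upper bound, the
  segments up to and including the elements of \<open>A\<close> would cover the field, but these are
  at most \<open>r\<close> many sets of size at most \<open>r\<close>.\<close>

lemma ex_above_underS:
  assumes r: "Cinfinite r" and A: "A \<subseteq> Field (cardSuc r)" "|A| \<le>o r"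
  shows "\<exists>x\<in>Field (cardSuc r). A \<subseteq> underS (cardSuc r) x"
proof (rule ccontr)
  let ?s = "cardSuc r"
  have s: "Card_order ?s" "Well_order ?s"
    using r cardSuc_Card_order[of r] cardSuc_Well_order[of r] by auto
  assume *: "\<not> ?thesis"
  have "Field ?s \<subseteq> (\<Union>a\<in>A. insert a (underS ?s a))"
  proof
    fix x assume x: "x \<in> Field ?s"
    then obtain a where "a \<in> A" "a \<notin> underS ?s x" using * by blast
    then show "x \<in> (\<Union>a\<in>A. insert a (underS ?s a))"
      using underS_linear[OF s(2) x, of a] A(1) by blast
  qed
  moreover have "|\<Union>a\<in>A. insert a (underS ?s a)| \<le>o r"
  proof (rule ordLeq_UN[OF r A(2)])
    fix a assume "a \<in> A"
    then have "|underS ?s a| \<le>o r"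
      using card_of_underS[OF s(1), of a] A(1) ordLess_cardSuc_iff[of r "underS ?s a"] r by auto
    moreover have "|{a}| \<le>o r"
      using finite_ordLess_Cinfinite[OF r, of "{a}"] ordLess_imp_ordLeq by auto
    ultimately show "|insert a (underS ?s a)| \<le>o r"
      using ordLeq_Un[OF r, of "{a}" "underS ?s a"] by simp
  qed
  ultimately have "|Field ?s| \<le>o r" using ordLeq_subset by blast
  with ordIso_symmetric[OF card_of_Field_ordIso[OF s(1)]] have "?s \<le>o r"
    by (rule ordIso_ordLeq_trans)
  then show False
    using cardSuc_greater[of r] r not_ordLess_ordLeq[of r ?s] by simp
qed

lemma ordLess_ex_notin:
  assumes "Card_order r" "|A| <o r"
  shows "\<exists>x\<in>Field r. x \<notin> A"
proof (rule ccontr)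
  assume "\<not> ?thesis"
  then have "|Field r| \<le>o |A|" using card_of_mono1[of "Field r" A] by blast
  with ordIso_symmetric[OF card_of_Field_ordIso[OF assms(1)]] have "r \<le>o |A|"
    by (rule ordIso_ordLeq_trans)
  then show False using assms(2) not_ordLess_ordLeq by blast
qed

section \<open>Generic functions\<close>

lemma (in abelian_monoid) finsum_Times:
  assumes "finite A" "finite B" "g \<in> A \<times> B \<rightarrow> carrier G"
  shows "finsum G g (A \<times> B) = (\<Oplus>x\<in>A. \<Oplus>y\<in>B. g (x, y))"
  using assms(1,3)
proof (induction A)
  case empty
  then show ?case by simp
next
  case (insert a A)
  have "insert a A \<times> B = Pair a ` B \<union> A \<times> B" by auto
  then have "finsum G g (insert a A \<times> B) = finsum G g (Pair a ` B \<union> A \<times> B)" by simp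
  also have "\<dots> = finsum G g (Pair a ` B) \<oplus> finsum G g (A \<times> B)"
    using insert assms(2) by (intro finsum_Un_disjoint) auto
  also have "finsum G g (Pair a ` B) = (\<Oplus>y\<in>B. g (a, y))"
    using insert by (intro finsum_reindex) (auto simp: inj_on_def)
  also have "finsum G g (A \<times> B) = (\<Oplus>x\<in>A. \<Oplus>y\<in>B. g (x, y))"
    using insert by (intro insert.IH) auto
  also have "(\<Oplus>y\<in>B. g (a, y)) \<oplus> (\<Oplus>x\<in>A. \<Oplus>y\<in>B. g (x, y))
      = (\<Oplus>x\<in>insert a A. \<Oplus>y\<in>B. g (x, y))"
    using insert by (intro finsum_insert[symmetric]) (auto intro!: finsum_closed)
  finally show ?case .
qed

lemma ordLess_inj:
  assumes "inj_on f A" "f ` A \<subseteq> B" "|B| <o r"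
  shows "|A| <o r"
proof -
  have "|A| \<le>o |B|" using card_of_ordLeq[of A B] assms(1,2) by blast
  then show ?thesis using assms(3) by (rule ordLeq_ordLess_trans)
qed

text \<open>In the undominated case \<open>v\<close> is a new column, \<open>f\<close> a combination
  of earlier columns and \<open>k\<close> the coefficient of the new column. The exceptional set
  depends only on \<open>f\<close> and the finite set \<open>C\<close> of coefficients, so one
  \<open>Z\<close> serves all \<open>S\<close>, \<open>u\<close> and \<open>k\<close>; a single
  point of \<open>S\<close> outside \<open>Z\<close> suffices.\<close>

definition (in field) generic :: "'k rel \<Rightarrow> 'x set \<Rightarrow> ('x \<Rightarrow> 'a) set \<Rightarrow> ('x \<Rightarrow> 'a) \<Rightarrow> bool" where
  "generic r K \<F> v \<longleftrightarrow> (\<forall>f\<in>\<F>. \<forall>C. finite C \<longrightarrow> C \<subseteq> carrier R - {\<zero>} \<longrightarrow>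
      (\<exists>Z. |Z| <o r \<and> (\<forall>S u k. finite S \<longrightarrow> S \<subseteq> K \<longrightarrow> \<not> S \<subseteq> Z \<longrightarrow> u \<in> S \<rightarrow> C \<longrightarrow> k \<in> C \<longrightarrow>
        (\<Oplus>x\<in>S. u x \<otimes> (k \<otimes> v x \<oplus> f x)) \<noteq> \<zero>)))"

text \<open>Recursion along an injection of \<open>K\<close> into the field of \<open>r\<close>. At
  each point fewer than \<open>r\<close> constraints are active, and each forbids one value, since
  the equation is linear in the new value with nonzero coefficient. The field has \<open>r\<close>
  elements, so a value is left.\<close>

lemma (in field) exists_generic_function:
  fixes r :: "'k rel" and K :: "'x set" and \<F> :: "('x \<Rightarrow> 'a) set"
  assumes r: "Cinfinite r" and R: "|carrier R| =o r"
    and K: "|K| \<le>o r" and F: "|\<F>| \<le>o r"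
    and Fc: "\<And>f x. f \<in> \<F> \<Longrightarrow> x \<in> K \<Longrightarrow> f x \<in> carrier R"
  shows "\<exists>v. (\<forall>x. v x \<in> carrier R) \<and> generic r K \<F> v"
proof -
  have rc: "Card_order r" and wo: "Well_order r" using r by auto
  obtain h where h: "inj_on h K" "h ` K \<subseteq> Field r" using exists_inj_Field[OF rc K] by blast
  obtain i where i: "inj_on i \<F>" "i ` \<F> \<subseteq> Field r" using exists_inj_Field[OF rc F] by blast
  obtain j where j: "inj_on j (carrier R)" "j ` carrier R \<subseteq> Field r"
    using exists_inj_Field[OF rc ordIso_imp_ordLeq[OF R]] by blast
  \<comment> \<open>Scalars, earlier points and functions enter the constraints at \<open>x\<close>
    only once their index is below that of \<open>x\<close>; this keeps their number below
    \<open>r\<close>.\<close>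
  define CC where "CC x = {c \<in> carrier R - {\<zero>}. j c \<in> underS r (h x)}" for x
  define KK where "KK x = {y \<in> K. h y \<in> underS r (h x)}" for x
  define FF where "FF x = {f \<in> \<F>. i f \<in> underS r (h x)}" for x
  \<comment> \<open>\<open>restrict\<close> shows that only values at earlier points matter, as the
    recursion requires. Outside \<open>K\<close> every field element is admissible.\<close>
  define P where "P v x a \<longleftrightarrow> a \<in> carrier R \<and> (x \<in> K \<longrightarrow>
    (\<forall>f\<in>FF x. \<forall>k\<in>CC x. \<forall>u0\<in>CC x. \<forall>S u. finite S \<longrightarrow> S \<subseteq> KK x \<longrightarrow> u \<in> S \<rightarrow> CC x \<longrightarrow>
      u0 \<otimes> (k \<otimes> a \<oplus> f x) \<oplus> (\<Oplus>y\<in>S. u y \<otimes> (k \<otimes> restrict v (KK x) y \<oplus> f y)) \<noteq> \<zero>))" for v x a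
  define Rel where "Rel = {(y, x). h y \<in> underS r (h x)}"
  have "\<exists>v. \<forall>x. P v x (v x)"
  proof (rule dependent_wf_choice)
    have "Rel = inv_image {(x, y). x \<in> underS r y} h" by (auto simp: Rel_def)
    then show "wf Rel" using wf_underS[OF wo] by simp
  next
    fix v w :: "'x \<Rightarrow> 'a" and x a
    assume "\<And>z. (z, x) \<in> Rel \<Longrightarrow> v z = w z"
    then have "restrict v (KK x) = restrict w (KK x)" by (auto simp: Rel_def KK_def)
    then show "P v x a = P w x a" unfolding P_def by simp
  next
    fix w :: "'x \<Rightarrow> 'a" and x
    assume IH: "\<And>y. (y, x) \<in> Rel \<Longrightarrow> P w y (w y)"
    define v where "v = restrict w (KK x)"
    have vc: "v y \<in> carrier R" if "y \<in> KK x" for y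
      using IH[of y] that by (auto simp: Rel_def KK_def P_def v_def)
    show "\<exists>a. P w x a"
    proof (cases "x \<in> K")
      case False
      then show ?thesis unfolding P_def using zero_closed by blast
    next
      case True
      have tiny: "|underS r (h x)| <o r" using card_of_underS[OF rc] h(2) True by auto
      have tCC: "|CC x| <o r"
        using j(1) by (intro ordLess_inj[OF _ _ tiny, of j]) (auto simp: CC_def inj_on_def)
      have tKK: "|KK x| <o r"
        using h(1) by (intro ordLess_inj[OF _ _ tiny, of h]) (auto simp: KK_def inj_on_def)
      have tFF: "|FF x| <o r"
        using i(1) by (intro ordLess_inj[OF _ _ tiny, of i]) (auto simp: FF_def inj_on_def)
      define s where "s f k T = (\<Oplus>p\<in>T. snd p \<otimes> (k \<otimes> v (fst p) \<oplus> f (fst p)))" for f k T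
      \<comment> \<open>The value forbidden by a choice of parameters. The finite graph
        \<open>T\<close> codes \<open>S\<close> together with \<open>u\<close>, so that the
        parameters range over a set smaller than \<open>r\<close>.\<close>
      define g where "g = (\<lambda>(f, k, u0, T). THE a. a \<in> carrier R \<and>
        u0 \<otimes> (k \<otimes> a \<oplus> f x) \<oplus> s f k T = \<zero>)"
      define Ix where "Ix = FF x \<times> CC x \<times> CC x \<times> Fpow (KK x \<times> CC x)"
      have "|Ix| <o r" unfolding Ix_def
        using tCC tKK tFF by (intro ordLess_Times[OF r] ordLess_Fpow[OF r]) auto
      then have "|g ` Ix| <o r" by (rule ordLess_image)
      moreover have "\<not> |carrier R| <o r" using R not_ordLess_ordIso by blast
      ultimately have "\<not> carrier R \<subseteq> g ` Ix" using ordLess_subset by blast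
      then obtain a where a: "a \<in> carrier R" "a \<notin> g ` Ix" by blast
      have "u0 \<otimes> (k \<otimes> a \<oplus> f x) \<oplus> (\<Oplus>y\<in>S. u y \<otimes> (k \<otimes> v y \<oplus> f y)) \<noteq> \<zero>"
        if f: "f \<in> FF x" and k: "k \<in> CC x" and u0: "u0 \<in> CC x"
          and S: "finite S" "S \<subseteq> KK x" and u: "u \<in> S \<rightarrow> CC x" for f k u0 S u
      proof
        assume eq: "u0 \<otimes> (k \<otimes> a \<oplus> f x) \<oplus> (\<Oplus>y\<in>S. u y \<otimes> (k \<otimes> v y \<oplus> f y)) = \<zero>"
        define T where "T = (\<lambda>y. (y, u y)) ` S"
        have kc: "k \<in> carrier R" "k \<noteq> \<zero>" "u0 \<in> carrier R" "u0 \<noteq> \<zero>"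
          using k u0 by (auto simp: CC_def)
        have fc: "f y \<in> carrier R" if "y \<in> K" for y using f that Fc by (auto simp: FF_def)
        have uc: "u y \<in> carrier R" if "y \<in> S" for y using u that by (auto simp: CC_def)
        have tc: "u y \<otimes> (k \<otimes> v y \<oplus> f y) \<in> carrier R" if "y \<in> S" for y
          using that uc kc vc[of y] fc[of y] S(2) by (auto simp: KK_def)
        have sT: "s f k T = (\<Oplus>y\<in>S. u y \<otimes> (k \<otimes> v y \<oplus> f y))"
          unfolding s_def T_def using tc by (subst finsum_reindex) (auto simp: inj_on_def)
        then have sc: "s f k T \<in> carrier R" using tc by (auto intro!: finsum_closed)
        have "g (f, k, u0, T) = a" unfolding g_def prod.case
        proof (rule the_equality)
          show "a \<in> carrier R \<and> u0 \<otimes> (k \<otimes> a \<oplus> f x) \<oplus> s f k T = \<zero>"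
            using a(1) eq sT by simp
        next
          fix b assume b: "b \<in> carrier R \<and> u0 \<otimes> (k \<otimes> b \<oplus> f x) \<oplus> s f k T = \<zero>"
          then have "u0 \<otimes> (k \<otimes> b \<oplus> f x) \<oplus> s f k T = u0 \<otimes> (k \<otimes> a \<oplus> f x) \<oplus> s f k T"
            using eq sT by simp
          then have "u0 \<otimes> (k \<otimes> b \<oplus> f x) = u0 \<otimes> (k \<otimes> a \<oplus> f x)"
            using sc a(1) b kc fc[OF True] by (subst (asm) add.right_cancel) auto
          then have "k \<otimes> b \<oplus> f x = k \<otimes> a \<oplus> f x"
            using a(1) b kc fc[OF True] by (subst (asm) m_lcancel) auto
          then have "k \<otimes> b = k \<otimes> a"
            using a(1) b kc fc[OF True] by (subst (asm) add.right_cancel) auto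
          then show "b = a"
            using a(1) b kc by (subst (asm) m_lcancel) auto
        qed
        moreover have "(f, k, u0, T) \<in> Ix"
          using f k u0 S u unfolding Ix_def T_def Fpow_def by auto
        ultimately show False using a(2) by (metis imageI)
      qed
      then show ?thesis using a(1) True unfolding P_def v_def by blast
    qed
  qed
  then obtain v where v: "\<And>x. P v x (v x)" by blast
  have vc: "v x \<in> carrier R" for x using v[of x] by (simp add: P_def)
  have vP: "u0 \<otimes> (k \<otimes> v x \<oplus> f x) \<oplus> (\<Oplus>y\<in>S. u y \<otimes> (k \<otimes> restrict v (KK x) y \<oplus> f y)) \<noteq> \<zero>"
    if "x \<in> K" "f \<in> FF x" "k \<in> CC x" "u0 \<in> CC x" "finite S" "S \<subseteq> KK x" "u \<in> S \<rightarrow> CC x"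
    for x f k u0 S u
    using v[of x] that unfolding P_def by blast
  have "\<exists>Z. |Z| <o r \<and> (\<forall>S u k. finite S \<longrightarrow> S \<subseteq> K \<longrightarrow> \<not> S \<subseteq> Z \<longrightarrow> u \<in> S \<rightarrow> C \<longrightarrow> k \<in> C \<longrightarrow>
        (\<Oplus>x\<in>S. u x \<otimes> (k \<otimes> v x \<oplus> f x)) \<noteq> \<zero>)"
    if f: "f \<in> \<F>" and C: "finite C" "C \<subseteq> carrier R - {\<zero>}" for f C
  proof -
    define I where "I = insert (i f) (j ` C)"
    have I: "finite I" "I \<subseteq> Field r" using C f i(2) j(2) by (auto simp: I_def)
    \<comment> \<open>Beyond \<open>Z\<close> both \<open>f\<close> and all of \<open>C\<close> are
      listed. If a finite set is not contained in \<open>Z\<close>, its last point \<open>m\<close>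
      lies beyond these indices, and the constraint at \<open>m\<close> says that the sum is
      nonzero.\<close>
    define Z where "Z = (\<Union>t\<in>I. {x \<in> K. h x \<in> insert t (underS r t)})"
    have "|Z| <o r" unfolding Z_def
    proof (rule ordLess_UN_finite[OF r I(1)])
      fix t assume "t \<in> I"
      then have "|underS r t| <o r" using card_of_underS[OF rc] I(2) by blast
      then have "|{t} \<union> underS r t| <o r"
        using finite_ordLess_Cinfinite[OF r, of "{t}"] by (intro ordLess_Un[OF r]) auto
      then show "|{x \<in> K. h x \<in> insert t (underS r t)}| <o r"
        using h(1) by (intro ordLess_inj[of h _ "{t} \<union> underS r t"]) (auto simp: inj_on_def)
    qed
    moreover have "(\<Oplus>x\<in>S. u x \<otimes> (k \<otimes> v x \<oplus> f x)) \<noteq> \<zero>"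
      if S: "finite S" "S \<subseteq> K" "\<not> S \<subseteq> Z" and u: "u \<in> S \<rightarrow> C" and k: "k \<in> C" for S u k
    proof -
      obtain x0 where x0: "x0 \<in> S" "x0 \<notin> Z" using S by blast
      have "\<exists>m\<in>h ` S. \<forall>y\<in>h ` S - {m}. y \<in> underS r m"
        using S x0 h(2) by (intro underS_finite_max[OF wo]) auto
      then obtain m where m: "m \<in> S" "\<And>y. y \<in> S \<Longrightarrow> h y \<noteq> h m \<Longrightarrow> h y \<in> underS r (h m)"
        by blast
      have hm: "t \<in> underS r (h m)" if "t \<in> I" for t
      proof -
        have "t \<in> underS r (h x0)"
          using underS_linear[OF wo, of t "h x0"] that x0 I(2) S(2) h(2) by (auto simp: Z_def)
        then show ?thesis
          using m(2)[OF x0(1)] underS_trans[OF wo, of t "h x0" "h m"] by (cases "h x0 = h m") auto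
      qed
      have Cm: "C \<subseteq> CC m" using hm C by (auto simp: CC_def I_def)
      have mK: "m \<in> K" using m S by auto
      have "h y \<noteq> h m" if "y \<in> S - {m}" for y
        using that h(1) S(2) m(1) by (auto simp: inj_on_def)
      then have Sm: "S - {m} \<subseteq> KK m" using m(2) S(2) by (auto simp: KK_def)
      have tc: "u y \<otimes> (k \<otimes> v y \<oplus> f y) \<in> carrier R" if "y \<in> S" for y
      proof -
        have "u y \<in> carrier R" "k \<in> carrier R" "f y \<in> carrier R"
          using that u k C(2) Fc[OF f, of y] S(2) by auto
        then show ?thesis using vc by simp
      qed
      have "(\<Oplus>y\<in>S-{m}. u y \<otimes> (k \<otimes> restrict v (KK m) y \<oplus> f y))
          = (\<Oplus>y\<in>S-{m}. u y \<otimes> (k \<otimes> v y \<oplus> f y))"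
        using Sm tc by (intro finsum_cong') auto
      moreover have "f \<in> FF m" using f hm by (auto simp: FF_def I_def)
      moreover have "k \<in> CC m" "u m \<in> CC m" "u \<in> S - {m} \<rightarrow> CC m"
        using Cm k u m(1) by auto
      ultimately have "u m \<otimes> (k \<otimes> v m \<oplus> f m) \<oplus> (\<Oplus>y\<in>S-{m}. u y \<otimes> (k \<otimes> v y \<oplus> f y)) \<noteq> \<zero>"
        using vP[of m f k "u m" "S - {m}" u] mK S(1) Sm by (simp del: restrict_apply)
      moreover have "(\<Oplus>y\<in>insert m (S - {m}). u y \<otimes> (k \<otimes> v y \<oplus> f y))
        = u m \<otimes> (k \<otimes> v m \<oplus> f m) \<oplus> (\<Oplus>y\<in>S-{m}. u y \<otimes> (k \<otimes> v y \<oplus> f y))"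
        using S m(1) tc by (intro finsum_insert) auto
      moreover have "insert m (S - {m}) = S" using m(1) by auto
      ultimately show ?thesis by simp
    qed
    ultimately show ?thesis by blast
  qed
  then show ?thesis using vc unfolding generic_def by blast
qed

section \<open>Closed points and enumerations\<close>

locale infinite_cardinal =
  fixes \<kappa> :: "'k rel"
  assumes kappa: "Cinfinite \<kappa>"
begin

abbreviation r1 :: "'k set rel" where "r1 \<equiv> cardSuc \<kappa>"
abbreviation r2 :: "'k set set rel" where "r2 \<equiv> cardSuc (cardSuc \<kappa>)"

abbreviation less1 (infix "\<prec>\<^sub>1" 50) where "x \<prec>\<^sub>1 y \<equiv> x \<in> underS r1 y"
abbreviation less2 (infix "\<prec>\<^sub>2" 50) where "x \<prec>\<^sub>2 y \<equiv> x \<in> underS r2 y"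

lemma r1: "Cinfinite r1" and r2: "Cinfinite r2"
  by (intro Cinfinite_cardSuc kappa)+

lemma Card_kappa: "Card_order \<kappa>" and Card_r1: "Card_order r1" and Card_r2: "Card_order r2"
  using kappa r1 r2 by auto

lemma wo1: "Well_order r1" and wo2: "Well_order r2"
  using Card_r1 Card_r2 by auto

lemma card_underS1: "|underS r1 x| \<le>o \<kappa>"
proof (cases "x \<in> Field r1")
  case True
  then show ?thesis using card_of_underS[OF Card_r1] ordLess_cardSuc_iff[OF Card_kappa] by auto
next
  case False
  then show ?thesis
    using ordLess_imp_ordLeq[OF finite_ordLess_Cinfinite[OF kappa, of "{}"]]
    by (simp add: underS_empty)
qed

lemma card_underS2: "|underS r2 x| \<le>o r1"
proof (cases "x \<in> Field r2")
  case True
  then show ?thesis using card_of_underS[OF Card_r2] ordLess_cardSuc_iff[OF Card_r1] by auto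
next
  case False
  then show ?thesis
    using ordLess_imp_ordLeq[OF finite_ordLess_Cinfinite[OF r1, of "{}"]]
    by (simp add: underS_empty)
qed

lemma card_insert_underS1: "|insert y (underS r1 x)| \<le>o \<kappa>"
proof -
  have "|{y} \<union> underS r1 x| \<le>o \<kappa>"
    using card_underS1 finite_ordLess_Cinfinite[OF kappa, of "{y}"] ordLess_imp_ordLeq
    by (intro ordLeq_Un[OF kappa]) auto
  then show ?thesis by simp
qed

lemma kappa_le_r1: "|A| \<le>o \<kappa> \<Longrightarrow> |A| \<le>o r1"
  by (rule ordLeq_transitive[OF _ cardSuc_ordLeq[OF Card_kappa]])

text \<open>A strict upper bound, chosen arbitrarily; meaningful for sets of size at most \<open>\<kappa>\<close>.\<close>

definition ub :: "'k set set \<Rightarrow> 'k set" where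
  "ub A = (SOME x. x \<in> Field r1 \<and> A \<subseteq> underS r1 x)"

lemma ub:
  assumes "A \<subseteq> Field r1" "|A| \<le>o \<kappa>"
  shows "ub A \<in> Field r1" "\<And>a. a \<in> A \<Longrightarrow> a \<prec>\<^sub>1 ub A"
proof -
  have "\<exists>x. x \<in> Field r1 \<and> A \<subseteq> underS r1 x"
    using ex_above_underS[OF kappa assms] by blast
  from someI_ex[OF this] show "ub A \<in> Field r1" "\<And>a. a \<in> A \<Longrightarrow> a \<prec>\<^sub>1 ub A"
    unfolding ub_def by auto
qed

section \<open>Closed points of functions on the successor cardinal\<close>

definition closed_under :: "('k set \<Rightarrow> 'k set) \<Rightarrow> 'k set \<Rightarrow> bool" where
  "closed_under h z \<longleftrightarrow> z \<in> Field r1 \<and> (\<forall>x. x \<prec>\<^sub>1 z \<longrightarrow> h x \<prec>\<^sub>1 z)"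

text \<open>Starting with the segment up to \<open>x\<close>, add countably often the values of
  \<open>h\<close> together with everything below them. The union \<open>U\<close> is an initial
  segment of size at most \<kappa>, hence bounded. The points below the least point outside
  \<open>U\<close> are exactly those of \<open>U\<close>, so that point is closed.\<close>

lemma closed_under_exists:
  assumes h: "h \<in> Field r1 \<rightarrow> Field r1" and x: "x \<in> Field r1"
  shows "\<exists>z. closed_under h z \<and> x \<prec>\<^sub>1 z"
proof -
  define A where "A = rec_nat (insert x (underS r1 x))
    (\<lambda>_ B. B \<union> (\<Union>y\<in>B. insert (h y) (underS r1 (h y))))"
  have A0: "A 0 = insert x (underS r1 x)"
    and AS: "\<And>n. A (Suc n) = A n \<union> (\<Union>y\<in>A n. insert (h y) (underS r1 (h y)))"
    by (simp_all add: A_def)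
  have AF: "A n \<subseteq> Field r1" for n
  proof (induction n)
    case 0
    then show ?case using x underS_in_Field by (fastforce simp: A0)
  next
    case (Suc n)
    then have "h y \<in> Field r1" if "y \<in> A n" for y using h that by auto
    then show ?case using Suc underS_in_Field by (fastforce simp: AS)
  qed
  have Ac: "|A n| \<le>o \<kappa>" for n
  proof (induction n)
    case 0
    then show ?case using card_insert_underS1 by (simp add: A0)
  next
    case (Suc n)
    then show ?case unfolding AS
      using card_insert_underS1 by (intro ordLeq_Un[OF kappa] ordLeq_UN[OF kappa]) auto
  qed
  have Ad: "y \<in> A n \<Longrightarrow> w \<prec>\<^sub>1 y \<Longrightarrow> w \<in> A n" for n y w
  proof (induction n)
    case 0
    then show ?case using underS_trans[OF wo1, of w y x] by (auto simp: A0)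
  next
    case (Suc n)
    then show ?case using underS_trans[OF wo1, of w y] by (auto simp: AS)
  qed
  define U where "U = (\<Union>n. A n)"
  have "|U| \<le>o \<kappa>" unfolding U_def
  proof (rule ordLeq_UN[OF kappa])
    show "|UNIV :: nat set| \<le>o \<kappa>"
      using card_of_nat natLeq_ordLeq_cinfinite[OF kappa] by (rule ordIso_ordLeq_trans)
  qed (rule Ac)
  moreover have UF: "U \<subseteq> Field r1" using AF by (auto simp: U_def)
  ultimately obtain b where b: "b \<in> Field r1" "U \<subseteq> underS r1 b"
    using ex_above_underS[OF kappa] by blast
  have "b \<in> Field r1 \<and> b \<notin> U" using b by (auto simp: underS_def)
  from underS_least[OF wo1, of "\<lambda>b. b \<in> Field r1 \<and> b \<notin> U", OF this]
  obtain z where z: "z \<in> Field r1" "z \<notin> U"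
    and least: "\<forall>y\<in>underS r1 z. \<not> (y \<in> Field r1 \<and> y \<notin> U)" by auto
  have z3: "y \<in> U" if "y \<prec>\<^sub>1 z" for y
    using least that underS_in_Field[OF that] by simp
  have zU: "y \<prec>\<^sub>1 z" if "y \<in> U" for y
  proof -
    have "y \<in> Field r1" using that UF by blast
    moreover have "\<not> z \<prec>\<^sub>1 y" using that Ad[of y _ z] z(2) by (auto simp: U_def)
    ultimately show ?thesis using underS_linear[OF wo1, of y z] z(1,2) that by auto
  qed
  have "h y \<prec>\<^sub>1 z" if "y \<prec>\<^sub>1 z" for y
  proof -
    have "y \<in> U" using z3[OF that] .
    then obtain n where "y \<in> A n" by (auto simp: U_def)
    then have "h y \<in> A (Suc n)" by (auto simp: AS)
    then show ?thesis using zU by (auto simp: U_def)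
  qed
  moreover have "x \<in> U" unfolding U_def using A0 by blast
  ultimately show ?thesis using zU z(1) unfolding closed_under_def by blast
qed

text \<open>Two points have the same value exactly if no closed point separates them, so the fibres
  are the intervals between consecutive closed points. They become the blocks and stages of the
  matrix constructions.\<close>

definition next_closed :: "('k set \<Rightarrow> 'k set) \<Rightarrow> 'k set \<Rightarrow> 'k set" where
  "next_closed h x = (SOME z. closed_under h z \<and> x \<prec>\<^sub>1 z \<and>
     (\<forall>y. closed_under h y \<longrightarrow> x \<prec>\<^sub>1 y \<longrightarrow> \<not> y \<prec>\<^sub>1 z))"

lemma next_closed:
  assumes h: "h \<in> Field r1 \<rightarrow> Field r1" and x: "x \<in> Field r1"
  shows "closed_under h (next_closed h x)" "x \<prec>\<^sub>1 next_closed h x"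
    "\<And>y. closed_under h y \<Longrightarrow> x \<prec>\<^sub>1 y \<Longrightarrow> \<not> y \<prec>\<^sub>1 next_closed h x"
    "next_closed h x \<in> Field r1"
proof -
  obtain z0 where "closed_under h z0 \<and> x \<prec>\<^sub>1 z0" using closed_under_exists[OF h x] by blast
  from underS_least[OF wo1, of "\<lambda>z. closed_under h z \<and> x \<prec>\<^sub>1 z", OF this]
  have "\<exists>z. closed_under h z \<and> x \<prec>\<^sub>1 z \<and> (\<forall>y. closed_under h y \<longrightarrow> x \<prec>\<^sub>1 y \<longrightarrow> \<not> y \<prec>\<^sub>1 z)"
    by blast
  from someI_ex[OF this]
  show "closed_under h (next_closed h x)" "x \<prec>\<^sub>1 next_closed h x"
    "\<And>y. closed_under h y \<Longrightarrow> x \<prec>\<^sub>1 y \<Longrightarrow> \<not> y \<prec>\<^sub>1 next_closed h x"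
    unfolding next_closed_def by blast+
  then show "next_closed h x \<in> Field r1" by (simp add: closed_under_def)
qed

lemma next_closed_unique:
  assumes h: "h \<in> Field r1 \<rightarrow> Field r1" and x: "x \<in> Field r1"
    and z: "closed_under h z" "x \<prec>\<^sub>1 z" "\<And>y. closed_under h y \<Longrightarrow> x \<prec>\<^sub>1 y \<Longrightarrow> \<not> y \<prec>\<^sub>1 z"
  shows "next_closed h x = z"
  using next_closed[OF h x] z underS_linear[OF wo1, of z "next_closed h x"]
  by (auto simp: closed_under_def)

section \<open>Enumerations of initial segments and their coherence\<close>

definition enum :: "'k set set \<Rightarrow> 'k set set \<Rightarrow> 'k set" where
  "enum b = (SOME f. inj_on f (underS r2 b) \<and> f ` underS r2 b \<subseteq> Field r1)"

lemma enum: "inj_on (enum b) (underS r2 b)" "\<And>a. a \<prec>\<^sub>2 b \<Longrightarrow> enum b a \<in> Field r1"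
  using someI_ex[OF exists_inj_Field[OF Card_r1 card_underS2[of b]]]
  unfolding enum_def by auto

lemma card_enum_below: "|{a. a \<prec>\<^sub>2 b \<and> enum b a \<prec>\<^sub>1 z}| \<le>o \<kappa>"
proof -
  have "inj_on (enum b) {a. a \<prec>\<^sub>2 b \<and> enum b a \<prec>\<^sub>1 z}"
    using enum(1)[of b] by (auto simp: inj_on_def)
  then have "|{a. a \<prec>\<^sub>2 b \<and> enum b a \<prec>\<^sub>1 z}| \<le>o |underS r1 z|"
    using card_of_ordLeq[of "{a. a \<prec>\<^sub>2 b \<and> enum b a \<prec>\<^sub>1 z}" "underS r1 z"] by blast
  then show ?thesis using card_underS1 by (rule ordLeq_transitive)
qed

lemma card_enum_le:
  assumes "z \<in> Field r1"
  shows "|{a. a \<prec>\<^sub>2 b \<and> \<not> z \<prec>\<^sub>1 enum b a}| \<le>o \<kappa>"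
proof -
  let ?A = "{a. a \<prec>\<^sub>2 b \<and> \<not> z \<prec>\<^sub>1 enum b a}"
  have "inj_on (enum b) ?A"
    using enum(1)[of b] by (auto simp: inj_on_def)
  moreover have "enum b ` ?A \<subseteq> insert z (underS r1 z)"
    using underS_linear[OF wo1 assms] enum(2)[of _ b] by blast
  ultimately have "|?A| \<le>o |insert z (underS r1 z)|"
    using card_of_ordLeq[of ?A "insert z (underS r1 z)"] by blast
  then show ?thesis using card_insert_underS1 by (rule ordLeq_transitive)
qed

text \<open>A point closed under a function
  dominating \<open>discrepancy d b\<close> cuts off the same part of \<open>d\<close> in both, see \<open>enum_transfer\<close>.\<close>

definition discrepancy :: "'k set set \<Rightarrow> 'k set set \<Rightarrow> 'k set \<Rightarrow> 'k set" where
  "discrepancy d b x = ub (enum b ` {a. a \<prec>\<^sub>2 d \<and> \<not> x \<prec>\<^sub>1 enum d a} \<union> enum d ` {a. a \<prec>\<^sub>2 d \<and> \<not> x \<prec>\<^sub>1 enum b a})"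

lemma discrepancy:
  assumes d: "d \<prec>\<^sub>2 b" and x: "x \<in> Field r1"
  shows "discrepancy d b x \<in> Field r1"
    "\<And>a. a \<prec>\<^sub>2 d \<Longrightarrow> \<not> x \<prec>\<^sub>1 enum d a \<Longrightarrow> enum b a \<prec>\<^sub>1 discrepancy d b x"
    "\<And>a. a \<prec>\<^sub>2 d \<Longrightarrow> \<not> x \<prec>\<^sub>1 enum b a \<Longrightarrow> enum d a \<prec>\<^sub>1 discrepancy d b x"
proof -
  let ?A = "enum b ` {a. a \<prec>\<^sub>2 d \<and> \<not> x \<prec>\<^sub>1 enum d a}"
  let ?B = "enum d ` {a. a \<prec>\<^sub>2 d \<and> \<not> x \<prec>\<^sub>1 enum b a}"
  have ab: "a \<prec>\<^sub>2 d \<Longrightarrow> a \<prec>\<^sub>2 b" for a using underS_trans[OF wo2 _ d] by blast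
  have AB: "?A \<union> ?B \<subseteq> Field r1" using ab enum(2) by blast
  have "|?B| \<le>o \<kappa>"
    using ab by (intro ordLeq_image ordLeq_subset[OF card_enum_le[OF x, of b]]) auto
  then have AB': "|?A \<union> ?B| \<le>o \<kappa>"
    by (intro ordLeq_Un[OF kappa] ordLeq_image[OF card_enum_le[OF x, of d]])
  show "discrepancy d b x \<in> Field r1"
    "\<And>a. a \<prec>\<^sub>2 d \<Longrightarrow> \<not> x \<prec>\<^sub>1 enum d a \<Longrightarrow> enum b a \<prec>\<^sub>1 discrepancy d b x"
    "\<And>a. a \<prec>\<^sub>2 d \<Longrightarrow> \<not> x \<prec>\<^sub>1 enum b a \<Longrightarrow> enum d a \<prec>\<^sub>1 discrepancy d b x"
    using ub[OF AB AB'] unfolding discrepancy_def by blast+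
qed

lemma max_below:
  assumes "x \<prec>\<^sub>1 z" "y \<prec>\<^sub>1 z"
  obtains m where "m \<prec>\<^sub>1 z" "\<not> m \<prec>\<^sub>1 x" "\<not> m \<prec>\<^sub>1 y"
proof (cases "x \<prec>\<^sub>1 y")
  case True
  then have "\<not> y \<prec>\<^sub>1 x" using underS_trans[OF wo1, of x y x] by (auto simp: underS_notIn)
  then show ?thesis using that[of y] assms by (simp add: underS_notIn)
next
  case False
  then show ?thesis using that[of x] assms by (simp add: underS_notIn)
qed

text \<open>If \<open>enum d a\<close> is below \<open>z\<close>, choose \<open>m\<close> below
  \<open>z\<close> that is at least \<open>t\<close> and at least \<open>enum d a\<close>. Then
  \<open>enum b a\<close> is below \<open>discrepancy d b m\<close>, which is below
  \<open>h m\<close>, which is below \<open>z\<close> by closure. The converse exchanges the two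
  enumerations; \<open>key\<close> covers both.\<close>

lemma enum_transfer:
  assumes h: "closed_under h z" and t: "t \<prec>\<^sub>1 z"
    and dom: "\<And>x. x \<in> Field r1 \<Longrightarrow> \<not> x \<prec>\<^sub>1 t \<Longrightarrow> discrepancy d b x \<prec>\<^sub>1 h x"
    and d: "d \<prec>\<^sub>2 b" and a: "a \<prec>\<^sub>2 d"
  shows "enum d a \<prec>\<^sub>1 z \<longleftrightarrow> enum b a \<prec>\<^sub>1 z"
proof -
  have key: "f a \<prec>\<^sub>1 z"
    if *: "e a \<prec>\<^sub>1 z" and **: "\<And>m. m \<in> Field r1 \<Longrightarrow> \<not> m \<prec>\<^sub>1 e a \<Longrightarrow> f a \<prec>\<^sub>1 discrepancy d b m" for e f :: "'k set set \<Rightarrow> 'k set"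
  proof -
    obtain m where m: "m \<prec>\<^sub>1 z" "\<not> m \<prec>\<^sub>1 e a" "\<not> m \<prec>\<^sub>1 t" using max_below[OF * t] by blast
    have mF: "m \<in> Field r1" using underS_in_Field[OF m(1)] by simp
    have "f a \<prec>\<^sub>1 h m" using mF m by (intro underS_trans[OF wo1 ** dom])
    moreover have "h m \<prec>\<^sub>1 z" using h m(1) by (auto simp: closed_under_def)
    ultimately show ?thesis by (rule underS_trans[OF wo1])
  qed
  show ?thesis
    using key[of "enum d" "enum b"] key[of "enum b" "enum d"] discrepancy(2,3)[OF d _ a] by metis
qed

text \<open>By \<open>enum_transfer\<close>, a closed point above \<open>t\<close> is above both
  values or above neither. Any other closed point is below \<open>z\<close>, while neither value is.
  So the same closed points lie above both values, and the least ones coincide.\<close>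

lemma next_closed_transfer:
  assumes hF: "h \<in> Field r1 \<rightarrow> Field r1"
    and h: "closed_under h z" and t: "t \<prec>\<^sub>1 z"
    and dom: "\<And>x. x \<in> Field r1 \<Longrightarrow> \<not> x \<prec>\<^sub>1 t \<Longrightarrow> discrepancy d b x \<prec>\<^sub>1 h x"
    and d: "d \<prec>\<^sub>2 b" and a: "a \<prec>\<^sub>2 d" and z: "\<not> enum d a \<prec>\<^sub>1 z \<or> \<not> enum b a \<prec>\<^sub>1 z"
  shows "next_closed h (enum d a) = next_closed h (enum b a)"
proof -
  have zF: "z \<in> Field r1" using h by (simp add: closed_under_def)
  have ab: "a \<prec>\<^sub>2 b" using underS_trans[OF wo2 a d] .
  have nz: "\<not> enum d a \<prec>\<^sub>1 z" "\<not> enum b a \<prec>\<^sub>1 z"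
    using z enum_transfer[OF h t dom d a] by blast+
  have F: "enum d a \<in> Field r1" "enum b a \<in> Field r1" using enum(2) a ab by blast+
  have tr: "enum d a \<prec>\<^sub>1 y \<longleftrightarrow> enum b a \<prec>\<^sub>1 y" if y: "closed_under h y" for y
  proof (cases "t \<prec>\<^sub>1 y")
    case True
    then show ?thesis using enum_transfer[OF y True dom d a] by blast
  next
    case False
    then have *: "\<not> z \<prec>\<^sub>1 y" using underS_trans[OF wo1 t, of y] by blast
    then show ?thesis
      using underS_not_le_trans[OF wo1 zF _ nz(1), of y] underS_not_le_trans[OF wo1 zF _ nz(2), of y]
      by blast
  qed
  show ?thesis
    using next_closed[OF hF F(2)] tr by (intro next_closed_unique[OF hF F(1)]) auto
qed

text \<open>In terms of cardinal invariants, the bounding number of \<open>\<kappa>\<^sup>+\<close> exceeds \<open>\<kappa>\<^sup>+\<^sup>+\<close>.\<close>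

definition dominated :: bool where
  "dominated \<longleftrightarrow> (\<forall>\<F> \<subseteq> Field r1 \<rightarrow> Field r1. |\<F>| \<le>o r2 \<longrightarrow>
    (\<exists>g\<in>Field r1 \<rightarrow> Field r1. \<forall>f\<in>\<F>. \<exists>t\<in>Field r1. \<forall>x\<in>Field r1. \<not> x \<prec>\<^sub>1 t \<longrightarrow> f x \<prec>\<^sub>1 g x))"

lemma max_Field:
  assumes "x \<in> Field r1" "y \<in> Field r1"
  obtains m where "m \<in> Field r1" "\<And>z. z \<in> Field r1 \<Longrightarrow> \<not> z \<prec>\<^sub>1 m \<Longrightarrow> \<not> z \<prec>\<^sub>1 x \<and> \<not> z \<prec>\<^sub>1 y"
proof (cases "x \<prec>\<^sub>1 y")
  case True
  then have "z \<prec>\<^sub>1 y" if "z \<prec>\<^sub>1 x" for z using underS_trans[OF wo1 that] by simp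
  then show ?thesis using that[of y] assms by blast
next
  case False
  then have "z \<prec>\<^sub>1 x" if "z \<prec>\<^sub>1 y" for z using underS_le_trans[OF wo1 that assms(1)] by simp
  then show ?thesis using that[of x] assms by blast
qed

text \<open>\<open>F b\<close> is built by recursion to bound eventually the \<open>b\<close>-th
  member of an unbounded family, all earlier \<open>F d\<close> and all
  \<open>discrepancy d b\<close>. At \<open>x\<close> only the \<open>d\<close> with
  \<open>enum b d\<close> at most \<open>x\<close> are considered: these are at most \<kappa> many,
  so a strict bound exists, and every \<open>d\<close> is included from \<open>enum b d\<close> on.
  If \<open>g\<close> does not dominate the \<open>b\<close>-th member, it is exceeded unboundedly
  often by every later member of the chain.\<close>

lemma unbounded_chain:
  assumes "\<not> dominated"
  obtains F where "\<And>b. b \<in> Field r2 \<Longrightarrow> F b \<in> Field r1 \<rightarrow> Field r1"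
    and "\<And>b d x. b \<in> Field r2 \<Longrightarrow> d \<prec>\<^sub>2 b \<Longrightarrow> x \<in> Field r1 \<Longrightarrow> \<not> x \<prec>\<^sub>1 enum b d \<Longrightarrow> discrepancy d b x \<prec>\<^sub>1 F b x"
    and "\<And>g. g \<in> Field r1 \<rightarrow> Field r1 \<Longrightarrow> \<exists>b\<in>Field r2. \<forall>\<beta>. b \<prec>\<^sub>2 \<beta> \<longrightarrow>
      (\<forall>t\<in>Field r1. \<exists>x\<in>Field r1. \<not> x \<prec>\<^sub>1 t \<and> g x \<prec>\<^sub>1 F \<beta> x)"
proof -
  obtain \<F> where F: "\<F> \<subseteq> Field r1 \<rightarrow> Field r1" "|\<F>| \<le>o r2"
    and unb: "\<And>g. g \<in> Field r1 \<rightarrow> Field r1 \<Longrightarrow>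
      \<exists>f\<in>\<F>. \<forall>t\<in>Field r1. \<exists>x\<in>Field r1. \<not> x \<prec>\<^sub>1 t \<and> \<not> f x \<prec>\<^sub>1 g x"
    using assms unfolding dominated_def by (auto 0 4)
  have "\<F> \<noteq> {}" using unb[of "\<lambda>x. x"] by auto
  moreover have "|\<F>| \<le>o |Field r2|"
    using F(2) ordIso_symmetric[OF card_of_Field_ordIso[OF Card_r2]] by (rule ordLeq_ordIso_trans)
  ultimately obtain e where e: "e ` Field r2 = \<F>"
    using card_of_ordLeq2[of \<F> "Field r2"] by auto
  have eF: "e b x \<in> Field r1" if "b \<in> Field r2" "x \<in> Field r1" for b x
    using e F(1) that by blast
  define P where "P F b h \<longleftrightarrow> (b \<in> Field r2 \<longrightarrow> h \<in> Field r1 \<rightarrow> Field r1 \<and> (\<forall>x\<in>Field r1. e b x \<prec>\<^sub>1 h x \<and>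
    (\<forall>d. d \<prec>\<^sub>2 b \<longrightarrow> \<not> x \<prec>\<^sub>1 enum b d \<longrightarrow> F d x \<prec>\<^sub>1 h x \<and> discrepancy d b x \<prec>\<^sub>1 h x)))"
    for F :: "'k set set \<Rightarrow> 'k set \<Rightarrow> 'k set" and b h
  have "\<exists>F. \<forall>b. P F b (F b)"
  proof (rule dependent_wf_choice[OF wf_underS[OF wo2]])
    fix F G :: "'k set set \<Rightarrow> 'k set \<Rightarrow> 'k set" and b h
    assume "\<And>z. (z, b) \<in> {(x, y). x \<prec>\<^sub>2 y} \<Longrightarrow> F z = G z"
    then show "P F b h = P G b h" by (auto simp: P_def)
  next
    fix b and F :: "'k set set \<Rightarrow> 'k set \<Rightarrow> 'k set"
    assume IH: "\<And>y. (y, b) \<in> {(x, y). x \<prec>\<^sub>2 y} \<Longrightarrow> P F y (F y)"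
    have FF: "F d x \<in> Field r1" if "d \<prec>\<^sub>2 b" "x \<in> Field r1" for d x
      using IH[of d] that underS_in_Field[OF that(1)] by (auto simp: P_def)
    define A where "A x = {d. d \<prec>\<^sub>2 b \<and> \<not> x \<prec>\<^sub>1 enum b d}" for x
    define B where "B x = insert (e b x) ((\<lambda>d. F d x) ` A x \<union> (\<lambda>d. discrepancy d b x) ` A x)" for x
    have "P F b (\<lambda>x. ub (B x))"
    proof (cases "b \<in> Field r2")
      case True
      have B: "B x \<subseteq> Field r1" "|B x| \<le>o \<kappa>" if x: "x \<in> Field r1" for x
      proof -
        show "B x \<subseteq> Field r1"
          using FF x eF[OF True x] discrepancy(1)[OF _ x] by (auto simp: B_def A_def)
        have "|A x| \<le>o \<kappa>" unfolding A_def by (rule card_enum_le[OF x])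
        moreover have "|{e b x}| \<le>o \<kappa>"
          by (rule ordLess_imp_ordLeq[OF finite_ordLess_Cinfinite[OF kappa]]) simp
        ultimately have "|{e b x} \<union> ((\<lambda>d. F d x) ` A x \<union> (\<lambda>d. discrepancy d b x) ` A x)| \<le>o \<kappa>"
          by (intro ordLeq_Un[OF kappa] ordLeq_image)
        then show "|B x| \<le>o \<kappa>" by (simp add: B_def)
      qed
      have "e b x \<in> B x" "d \<prec>\<^sub>2 b \<Longrightarrow> \<not> x \<prec>\<^sub>1 enum b d \<Longrightarrow> F d x \<in> B x \<and> discrepancy d b x \<in> B x" for x d
        by (auto simp: B_def A_def)
      then show ?thesis using ub[OF B] unfolding P_def by auto
    qed (simp add: P_def)
    then show "\<exists>h. P F b h" by blast
  qed
  then obtain F where F': "\<And>b. P F b (F b)" by blast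
  show thesis
  proof (rule that[of F])
    fix g assume g: "g \<in> Field r1 \<rightarrow> Field r1"
    then obtain f where f: "f \<in> \<F>" "\<forall>t\<in>Field r1. \<exists>x\<in>Field r1. \<not> x \<prec>\<^sub>1 t \<and> \<not> f x \<prec>\<^sub>1 g x"
      using unb[OF g] by blast
    then obtain b where b: "b \<in> Field r2" "f = e b" using e by blast
    have "\<exists>x\<in>Field r1. \<not> x \<prec>\<^sub>1 t \<and> g x \<prec>\<^sub>1 F \<beta> x" if be: "b \<prec>\<^sub>2 \<beta>" and t: "t \<in> Field r1" for \<beta> t
    proof -
      have \<beta>: "\<beta> \<in> Field r2" using underS_in_Field[OF be] by simp
      \<comment> \<open>From \<open>m\<close> on, \<open>F \<beta>\<close> exceeds
        \<open>F b\<close>, and the prescribed \<open>t\<close> is passed as well.\<close>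
      obtain m where m: "m \<in> Field r1" "\<And>z. z \<in> Field r1 \<Longrightarrow> \<not> z \<prec>\<^sub>1 m \<Longrightarrow> \<not> z \<prec>\<^sub>1 t \<and> \<not> z \<prec>\<^sub>1 enum \<beta> b"
        using max_Field[OF t enum(2)[OF be]] by blast
      then obtain x where x: "x \<in> Field r1" "\<not> x \<prec>\<^sub>1 m" "\<not> e b x \<prec>\<^sub>1 g x" using f b by blast
      have "e b x \<prec>\<^sub>1 F b x" using F'[of b] x b by (auto simp: P_def)
      also have "F b x \<prec>\<^sub>1 F \<beta> x" using F'[of \<beta>] x m(2)[OF x(1,2)] be \<beta> by (auto simp: P_def)
      finally (underS_trans[OF wo1]) have "e b x \<prec>\<^sub>1 F \<beta> x" .
      then have "g x \<prec>\<^sub>1 F \<beta> x"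
        using x(3) g x(1) by (intro underS_not_le_trans[OF wo1, of "g x" "e b x"]) auto
      then show ?thesis using m(2)[OF x(1,2)] x(1) by blast
    qed
    then show "\<exists>b\<in>Field r2. \<forall>\<beta>. b \<prec>\<^sub>2 \<beta> \<longrightarrow>
      (\<forall>t\<in>Field r1. \<exists>x\<in>Field r1. \<not> x \<prec>\<^sub>1 t \<and> g x \<prec>\<^sub>1 F \<beta> x)" using b(1) by blast
  qed (use F' in \<open>auto simp: P_def\<close>)
qed

end

section \<open>Families of vectors with disjoint supports\<close>

locale infinite_field = infinite_cardinal \<kappa> + field R
  for \<kappa> :: "'k rel" and R :: "('a, 'm) ring_scheme" (structure) +
  assumes card_carrier: "|carrier R| =o \<kappa>"
begin

definition supp :: "('k set set \<Rightarrow> 'a) \<Rightarrow> 'k set set set" where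
  "supp u = {x. u x \<noteq> \<zero>}"

text \<open>One finite coefficient set for the whole family allows a single exceptional set of a
  generic function to serve all its members.\<close>

definition disjoint_family :: "('k set set \<Rightarrow> 'a) set \<Rightarrow> 'a set \<Rightarrow> bool" where
  "disjoint_family X C \<longleftrightarrow> finite C \<and> C \<subseteq> carrier R - {\<zero>} \<and>
    (\<forall>u\<in>X. finite (supp u) \<and> supp u \<noteq> {} \<and> supp u \<subseteq> Field r2 \<and> u \<in> supp u \<rightarrow> C) \<and>
    (\<forall>u\<in>X. \<forall>v\<in>X. u \<noteq> v \<longrightarrow> supp u \<inter> supp v = {})"

lemma disjoint_family_mono: "disjoint_family X C \<Longrightarrow> Y \<subseteq> X \<Longrightarrow> disjoint_family Y C"
  unfolding disjoint_family_def by (meson subsetD)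

lemma card_family_hitting:
  assumes "disjoint_family X C"
  shows "|{u \<in> X. supp u \<inter> A \<noteq> {}}| \<le>o |A|"
  using assms by (intro card_of_hitting) (auto simp: disjoint_family_def)

lemma family_avoiding:
  assumes "disjoint_family X C" "Cinfinite r" "\<not> |X| \<le>o r" "|A| \<le>o r"
  shows "\<not> |{u \<in> X. supp u \<inter> A = {}}| \<le>o r"
proof -
  have "|{u \<in> X. supp u \<inter> A \<noteq> {}}| \<le>o r"
    using card_family_hitting[OF assms(1)] assms(4) by (rule ordLeq_transitive)
  from not_ordLeq_Diff[OF assms(2,3) this] show ?thesis
    by (rule contrapos_nn) (erule ordLeq_subset, blast)
qed

lemma not_ordLeq_ex: "\<not> |A| \<le>o r \<Longrightarrow> Cinfinite r \<Longrightarrow> \<exists>x. x \<in> A"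
  using finite_ordLess_Cinfinite[of r "{}"] ordLess_imp_ordLeq[of "|{}|" r] by (cases "A = {}") auto

lemma card_insert_underS2:
  "|insert b (underS r2 b)| \<le>o r1"
proof -
  have "|{b} \<union> underS r2 b| \<le>o r1"
    using ordLess_imp_ordLeq[OF finite_ordLess_Cinfinite[OF r1, of "{b}"]] card_underS2
    by (intro ordLeq_Un[OF r1]) auto
  then show ?thesis by simp
qed

lemma family_above:
  assumes Y: "disjoint_family Y D" and card: "\<not> |Y| \<le>o r1" and b: "b \<in> Field r2"
  shows "\<exists>w\<in>Y. \<forall>y\<in>supp w. b \<prec>\<^sub>2 y"
proof -
  from not_ordLeq_ex[OF family_avoiding[OF Y r1 card card_insert_underS2[of b]] r1]
  obtain w where w: "w \<in> Y" "supp w \<inter> insert b (underS r2 b) = {}" by blast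
  have "b \<prec>\<^sub>2 y" if "y \<in> supp w" for y
    using that w Y underS_linear[OF wo2 b, of y] unfolding disjoint_family_def by blast
  then show ?thesis using w by blast
qed

lemma not_ordLeq_kappa:
  assumes "\<not> |X| \<le>o \<kappa>" obtains V where "V \<subseteq> X" "|V| =o \<kappa>"
proof -
  have "r1 \<le>o |X|" using cardSuc_ordLeq_iff[OF Card_kappa] assms by blast
  with cardSuc_ordLeq[OF Card_kappa] have "\<kappa> \<le>o |X|" by (rule ordLeq_transitive)
  then show ?thesis using exists_subset_ordIso[OF Card_kappa] that by blast
qed

text \<open>Discarding the members that meet the at most \<kappa> points enumerated before
  \<open>x\<close> leaves more than \<kappa>. Keep \<kappa> of them and let \<open>g x\<close> bound
  the enumeration on their supports. Wherever the chain exceeds this \<open>g\<close>, the whole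
  window from \<open>x\<close> to \<open>g x\<close> fits below one closed point.\<close>

lemma family_spread:
  assumes X: "disjoint_family X C" and card: "\<not> |X| \<le>o \<kappa>"
    and d: "\<And>u. u \<in> X \<Longrightarrow> supp u \<subseteq> underS r2 d"
  shows "\<exists>g\<in>Field r1 \<rightarrow> Field r1. \<forall>x\<in>Field r1. \<exists>V\<subseteq>X. |V| =o \<kappa> \<and>
    (\<forall>u\<in>V. \<forall>a\<in>supp u. \<not> enum d a \<prec>\<^sub>1 x \<and> enum d a \<prec>\<^sub>1 g x)"
proof -
  have "\<exists>y\<in>Field r1. \<exists>V\<subseteq>X. |V| =o \<kappa> \<and> (\<forall>u\<in>V. \<forall>a\<in>supp u. \<not> enum d a \<prec>\<^sub>1 x \<and> enum d a \<prec>\<^sub>1 y)"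
    if x: "x \<in> Field r1" for x
  proof -
    define A where "A = {a. a \<prec>\<^sub>2 d \<and> enum d a \<prec>\<^sub>1 x}"
    have "|A| \<le>o \<kappa>" unfolding A_def by (rule card_enum_below)
    from not_ordLeq_kappa[OF family_avoiding[OF X kappa card this]]
    obtain V where V: "V \<subseteq> {u \<in> X. supp u \<inter> A = {}}" "|V| =o \<kappa>" by blast
    define B where "B = (\<Union>u\<in>V. enum d ` supp u)"
    have dV: "a \<prec>\<^sub>2 d" if "a \<in> supp u" "u \<in> V" for a u using d V(1) that by blast
    have B: "B \<subseteq> Field r1" using enum(2) dV by (auto simp: B_def)
    have "|B| \<le>o \<kappa>" unfolding B_def
    proof (rule ordLeq_UN[OF kappa ordIso_imp_ordLeq[OF V(2)]])
      fix u assume "u \<in> V"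
      then have "finite (enum d ` supp u)" using X V(1) by (auto simp: disjoint_family_def)
      then show "|enum d ` supp u| \<le>o \<kappa>"
        by (rule ordLess_imp_ordLeq[OF finite_ordLess_Cinfinite[OF kappa]])
    qed
    note ubB = ub[OF B this]
    have "\<forall>u\<in>V. \<forall>a\<in>supp u. \<not> enum d a \<prec>\<^sub>1 x \<and> enum d a \<prec>\<^sub>1 ub B"
    proof (intro ballI)
      fix u a assume ua: "u \<in> V" "a \<in> supp u"
      then have "a \<notin> A" using V(1) by blast
      moreover have "enum d a \<in> B" using ua by (auto simp: B_def)
      ultimately show "\<not> enum d a \<prec>\<^sub>1 x \<and> enum d a \<prec>\<^sub>1 ub B"
        using dV ua ubB(2) by (auto simp: A_def)
    qed
    then show ?thesis using ubB(1) V by blast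
  qed
  then have "\<exists>g. \<forall>x\<in>Field r1. g x \<in> Field r1 \<and> (\<exists>V\<subseteq>X. |V| =o \<kappa> \<and>
      (\<forall>u\<in>V. \<forall>a\<in>supp u. \<not> enum d a \<prec>\<^sub>1 x \<and> enum d a \<prec>\<^sub>1 g x))"
    by (intro bchoice) (simp add: Bex_def)
  then show ?thesis by (elim exE, intro bexI) auto
qed

text \<open>Only the values \<open>c x y\<close> with \<open>x \<prec>\<^sub>2 y\<close> matter here.\<close>

definition gross_coefficients :: "('k set set \<Rightarrow> 'k set set \<Rightarrow> 'a) \<Rightarrow> bool" where
  "gross_coefficients c \<longleftrightarrow> (\<forall>x y. c x y \<in> carrier R) \<and>
    (\<forall>X Y C D d. disjoint_family X C \<longrightarrow> disjoint_family Y D \<longrightarrow> \<not> |X| \<le>o \<kappa> \<longrightarrow> \<not> |Y| \<le>o r1 \<longrightarrow>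
      d \<in> Field r2 \<longrightarrow> (\<forall>u\<in>X. \<forall>x\<in>supp u. x \<prec>\<^sub>2 d) \<longrightarrow> (\<forall>w\<in>Y. \<forall>y\<in>supp w. d \<prec>\<^sub>2 y) \<longrightarrow>
      (\<exists>u\<in>X. \<exists>w\<in>Y. (\<Oplus>p\<in>supp u \<times> supp w. u (fst p) \<otimes> w (snd p) \<otimes> c (fst p) (snd p)) \<noteq> \<zero>))"

end

section \<open>The undominated case\<close>

context infinite_field
begin

lemma genericE:
  assumes "generic r K \<F> v" "f \<in> \<F>" "finite C" "C \<subseteq> carrier R - {\<zero>}"
  obtains Z where "|Z| <o r" "\<And>S u k. finite S \<Longrightarrow> S \<subseteq> K \<Longrightarrow> \<not> S \<subseteq> Z \<Longrightarrow> u \<in> S \<rightarrow> C \<Longrightarrow> k \<in> C \<Longrightarrow>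
    (\<Oplus>x\<in>S. u x \<otimes> (k \<otimes> v x \<oplus> f x)) \<noteq> \<zero>"
proof -
  note * = assms(1)[unfolded generic_def, THEN bspec, OF assms(2), THEN spec, THEN mp,
      OF assms(3), THEN mp, OF assms(4)]
  show thesis
    using * by (elim exE conjE) (rule that, assumption, simp)
qed

lemma generic_cong:
  assumes v: "generic r K \<F> v" and eq: "\<And>x. x \<in> K \<Longrightarrow> w x = v x"
    and vc: "\<And>x. v x \<in> carrier R" and fc: "\<And>f x. f \<in> \<F> \<Longrightarrow> x \<in> K \<Longrightarrow> f x \<in> carrier R"
  shows "generic r K \<F> w"
  unfolding generic_def
proof (intro ballI allI impI)
  fix f C assume f: "f \<in> \<F>" and C: "finite C" "C \<subseteq> carrier R - {\<zero>}"
  obtain Z where Z: "|Z| <o r" "\<And>S u k. finite S \<Longrightarrow> S \<subseteq> K \<Longrightarrow> \<not> S \<subseteq> Z \<Longrightarrow>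
      u \<in> S \<rightarrow> C \<Longrightarrow> k \<in> C \<Longrightarrow> (\<Oplus>x\<in>S. u x \<otimes> (k \<otimes> v x \<oplus> f x)) \<noteq> \<zero>"
    by (rule genericE[OF v f C]) (rule that)
  have "(\<Oplus>x\<in>S. u x \<otimes> (k \<otimes> w x \<oplus> f x)) = (\<Oplus>x\<in>S. u x \<otimes> (k \<otimes> v x \<oplus> f x))"
    if S: "S \<subseteq> K" and u: "u \<in> S \<rightarrow> C" and k: "k \<in> C" for S u k
  proof (rule finsum_cong')
    show "(\<lambda>x. u x \<otimes> (k \<otimes> v x \<oplus> f x)) \<in> S \<rightarrow> carrier R"
      using S u k C vc fc[OF f] by (intro Pi_I m_closed a_closed) auto
  qed (use S eq in auto)
  then show "\<exists>Z. |Z| <o r \<and> (\<forall>S u k. finite S \<longrightarrow> S \<subseteq> K \<longrightarrow> \<not> S \<subseteq> Z \<longrightarrow> u \<in> S \<rightarrow> C \<longrightarrow> k \<in> C \<longrightarrow>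
        (\<Oplus>x\<in>S. u x \<otimes> (k \<otimes> w x \<oplus> f x)) \<noteq> \<zero>)"
    using Z by (intro exI[of _ Z]) simp
qed

lemma ordLess_not_family:
  assumes V: "disjoint_family V C" "|V| =o \<kappa>" and Z: "|Z| <o \<kappa>"
  shows "\<exists>u\<in>V. supp u \<inter> Z = {}"
proof (rule ccontr)
  assume "\<not> ?thesis"
  then have sub: "V \<subseteq> {u \<in> V. supp u \<inter> Z \<noteq> {}}" by blast
  have "|{u \<in> V. supp u \<inter> Z \<noteq> {}}| <o \<kappa>"
    using card_family_hitting[OF V(1)] Z by (rule ordLeq_ordLess_trans)
  then have "|V| <o \<kappa>" using sub by (rule ordLess_subset)
  then show False using V(2) not_ordLess_ordIso by blast
qed

text \<open>The sum is controlled at the topmost point \<beta> of the support of \<open>w\<close>.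
  Column \<beta> is generic over combinations of the other columns of \<open>w\<close>, provided
  these are listed in \<open>A \<beta> z\<close> and the support of \<open>u\<close> lies in the
  block \<open>K \<beta> z\<close>; the choice of \<open>z\<close> secures both.\<close>

lemma exists_gross_coefficients_unbounded:
  assumes "\<not> dominated"
  shows "\<exists>c. gross_coefficients c"
proof -
  obtain F where F: "\<And>b. b \<in> Field r2 \<Longrightarrow> F b \<in> Field r1 \<rightarrow> Field r1"
    and F_discrepancy: "\<And>b d x. b \<in> Field r2 \<Longrightarrow> d \<prec>\<^sub>2 b \<Longrightarrow> x \<in> Field r1 \<Longrightarrow> \<not> x \<prec>\<^sub>1 enum b d \<Longrightarrow> discrepancy d b x \<prec>\<^sub>1 F b x"
    and unb: "\<And>g. g \<in> Field r1 \<rightarrow> Field r1 \<Longrightarrow> \<exists>b\<in>Field r2. \<forall>\<beta>. b \<prec>\<^sub>2 \<beta> \<longrightarrow>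
      (\<forall>t\<in>Field r1. \<exists>x\<in>Field r1. \<not> x \<prec>\<^sub>1 t \<and> g x \<prec>\<^sub>1 F \<beta> x)"
    using unbounded_chain[OF assms] by blast
  \<comment> \<open>\<open>K b z\<close> is a block of rows between consecutive closed points of
    \<open>F b\<close>, and \<open>A b z\<close> indexes the at most \<kappa> earlier columns taken
    into account there. During the construction the first argument of \<open>c\<close> is the later
    index.\<close>
  define A where "A b z = {a. a \<prec>\<^sub>2 b \<and> enum b a \<prec>\<^sub>1 z}" for b z
  define K where "K b z = {a. a \<prec>\<^sub>2 b \<and> next_closed (F b) (enum b a) = z}" for b z
  \<comment> \<open>A combination of columns is coded by a finite set of pairs of a column index and
    a coefficient, so that each \<open>\<F> c b z\<close> has size at most \<kappa>.
    \<open>restrict\<close> shows that only earlier columns enter.\<close>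
  define comb where "comb c b z T a = (\<Oplus>p\<in>T. snd p \<otimes> restrict c (A b z) (fst p) a)"
    for c :: "'k set set \<Rightarrow> 'k set set \<Rightarrow> 'a" and b z a and T :: "('k set set \<times> 'a) set"
  define \<F> where "\<F> c b z = comb c b z ` Fpow (A b z \<times> carrier R)" for c b z
  define P where "P c b v \<longleftrightarrow> (\<forall>a. v a \<in> carrier R) \<and>
    (b \<in> Field r2 \<longrightarrow> (\<forall>z. generic \<kappa> (K b z) (\<F> c b z) v))" for c b v
  have A: "|A b z| \<le>o \<kappa>" for b z unfolding A_def by (rule card_enum_below)
  have K: "|K b z| \<le>o \<kappa>" if b: "b \<in> Field r2" for b z
  proof (rule ordLeq_subset[OF A[of b z]])
    show "K b z \<subseteq> A b z"
      using next_closed(2)[OF F[OF b] enum(2)] by (auto simp: K_def A_def)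
  qed
  have combc: "comb c b z T a \<in> carrier R"
    if "\<And>d a. d \<prec>\<^sub>2 b \<Longrightarrow> c d a \<in> carrier R" "T \<subseteq> A b z \<times> carrier R" for c b z T a
    using that unfolding comb_def by (intro finsum_closed) (auto simp: A_def)
  have "\<exists>c. \<forall>b. P c b (c b)"
  proof (rule dependent_wf_choice[OF wf_underS[OF wo2]])
    fix c c' :: "'k set set \<Rightarrow> 'k set set \<Rightarrow> 'a" and b v
    assume "\<And>z. (z, b) \<in> {(x, y). x \<prec>\<^sub>2 y} \<Longrightarrow> c z = c' z"
    then have "restrict c (A b z) = restrict c' (A b z)" for z by (auto simp: A_def)
    then have "\<F> c b z = \<F> c' b z" for z unfolding \<F>_def comb_def by simp
    then show "P c b v = P c' b v" by (simp add: P_def)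
  next
    fix b and c :: "'k set set \<Rightarrow> 'k set set \<Rightarrow> 'a"
    assume "\<And>y. (y, b) \<in> {(x, y). x \<prec>\<^sub>2 y} \<Longrightarrow> P c y (c y)"
    then have cc: "c d a \<in> carrier R" if "d \<prec>\<^sub>2 b" for d a using that by (auto simp: P_def)
    show "\<exists>v. P c b v"
    proof (cases "b \<in> Field r2")
      case False
      then show ?thesis by (intro exI[of _ "\<lambda>_. \<zero>"]) (simp add: P_def)
    next
      case True
      have fc: "f a \<in> carrier R" if "f \<in> \<F> c b z" for f z a
        using that combc[of b c _ z a] cc by (auto simp: \<F>_def Fpow_def)
      have "\<exists>v. (\<forall>x. v x \<in> carrier R) \<and> generic \<kappa> (K b z) (\<F> c b z) v" for z
      proof (rule exists_generic_function[OF kappa card_carrier K[OF True]])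
        show "|\<F> c b z| \<le>o \<kappa>" unfolding \<F>_def
          using A ordIso_imp_ordLeq[OF card_carrier]
          by (intro ordLeq_image ordLeq_Fpow[OF kappa] ordLeq_Times[OF kappa])
      qed (use fc in auto)
      then obtain V where V: "\<And>z x. V z x \<in> carrier R" "\<And>z. generic \<kappa> (K b z) (\<F> c b z) (V z)"
        by metis
      \<comment> \<open>The blocks of one column are disjoint, so the generic functions on them can
        be glued.\<close>
      define v where "v a = V (next_closed (F b) (enum b a)) a" for a
      have "generic \<kappa> (K b z) (\<F> c b z) v" for z
        by (rule generic_cong[OF V(2)]) (use V(1) fc in \<open>auto simp: v_def K_def\<close>)
      then show ?thesis using V(1) by (intro exI[of _ v]) (simp add: P_def v_def)
    qed
  qed
  then obtain c where c: "\<And>b. P c b (c b)" by blast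
  have cc: "c b a \<in> carrier R" for a b using c[of b] by (simp add: P_def)
  have "gross_coefficients (\<lambda>x y. c y x)"
    unfolding gross_coefficients_def
  proof (intro conjI allI impI)
    fix X Y C D d
    assume X: "disjoint_family X C" and Y: "disjoint_family Y D"
      and cX: "\<not> |X| \<le>o \<kappa>" and cY: "\<not> |Y| \<le>o r1" and d: "d \<in> Field r2"
      and Xd: "\<forall>u\<in>X. \<forall>x\<in>supp u. x \<prec>\<^sub>2 d" and Yd: "\<forall>w\<in>Y. \<forall>y\<in>supp w. d \<prec>\<^sub>2 y"
    obtain g where g: "g \<in> Field r1 \<rightarrow> Field r1" and spread: "\<And>x. x \<in> Field r1 \<Longrightarrow> \<exists>V\<subseteq>X. |V| =o \<kappa> \<and>
        (\<forall>u\<in>V. \<forall>a\<in>supp u. \<not> enum d a \<prec>\<^sub>1 x \<and> enum d a \<prec>\<^sub>1 g x)"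
      using family_spread[OF X cX, of d] Xd by blast
    obtain b0 where b0: "b0 \<in> Field r2" "\<And>\<beta> t. b0 \<prec>\<^sub>2 \<beta> \<Longrightarrow> t \<in> Field r1 \<Longrightarrow>
        \<exists>x\<in>Field r1. \<not> x \<prec>\<^sub>1 t \<and> g x \<prec>\<^sub>1 F \<beta> x"
      using unb[OF g] by blast
    obtain w where w: "w \<in> Y" "\<forall>y\<in>supp w. b0 \<prec>\<^sub>2 y" using family_above[OF Y cY b0(1)] by blast
    have wfin: "finite (supp w)" "supp w \<noteq> {}" "supp w \<subseteq> Field r2" "\<And>y. y \<in> supp w \<Longrightarrow> w y \<in> D"
      using w(1) Y by (auto simp: disjoint_family_def)
    from underS_finite_max[OF wo2 wfin(1-3)] obtain \<beta>
      where \<beta>: "\<beta> \<in> supp w" "\<And>y. y \<in> supp w - {\<beta>} \<Longrightarrow> y \<prec>\<^sub>2 \<beta>" by blast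
    have \<beta>F: "\<beta> \<in> Field r2" and d\<beta>: "d \<prec>\<^sub>2 \<beta>" and b0\<beta>: "b0 \<prec>\<^sub>2 \<beta>"
      using \<beta>(1) wfin w Yd by blast+
    note FF = F[OF \<beta>F]
    \<comment> \<open>From \<open>m\<close> on, the enumeration at \<beta> has listed
      \<open>d\<close> and all other support points of \<open>w\<close>.\<close>
    define m where "m = ub (enum \<beta> ` insert d (supp w - {\<beta>}))"
    have mB: "enum \<beta> ` insert d (supp w - {\<beta>}) \<subseteq> Field r1" using enum(2) d\<beta> \<beta>(2) by blast
    have "|enum \<beta> ` insert d (supp w - {\<beta>})| \<le>o \<kappa>"
      using wfin(1) by (intro ordLess_imp_ordLeq[OF finite_ordLess_Cinfinite[OF kappa]]) auto
    note m = ub[OF mB this, folded m_def]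
    define z0 where "z0 = next_closed (F \<beta>) m"
    note z0 = next_closed[OF FF m(1), folded z0_def]
    \<comment> \<open>\<open>F \<beta>\<close> exceeds \<open>g\<close> at some point not before
      \<open>z0\<close>. As the next closed point \<open>z\<close> is closed under
      \<open>F \<beta>\<close>, it lies above \<open>g x\<close>.\<close>
    obtain x where x: "x \<in> Field r1" "\<not> x \<prec>\<^sub>1 z0" "g x \<prec>\<^sub>1 F \<beta> x"
      using b0(2)[OF b0\<beta> z0(4)] by blast
    define z where "z = next_closed (F \<beta>) x"
    note z = next_closed[OF FF x(1), folded z_def]
    have mx: "m \<prec>\<^sub>1 x" using underS_le_trans[OF wo1 z0(2) x(1,2)] .
    have mz: "m \<prec>\<^sub>1 z" using underS_trans[OF wo1 mx z(2)] .
    have gz: "g x \<prec>\<^sub>1 z"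
      using underS_trans[OF wo1 x(3)] z(1,2) by (auto simp: closed_under_def)
    obtain V where V: "V \<subseteq> X" "|V| =o \<kappa>"
        "\<And>u a. u \<in> V \<Longrightarrow> a \<in> supp u \<Longrightarrow> \<not> enum d a \<prec>\<^sub>1 x \<and> enum d a \<prec>\<^sub>1 g x"
      using spread[OF x(1)] by blast
    have ed: "enum \<beta> d \<prec>\<^sub>1 z0" using m(2)[of "enum \<beta> d"] z0(2) by (auto intro: underS_trans[OF wo1])
    \<comment> \<open>No closed point lies strictly between \<open>x\<close> and \<open>z\<close>,
      which determines the block according to \<open>enum d\<close>. The transfer with threshold
      \<open>enum \<beta> d\<close> gives the same block according to
      \<open>enum \<beta>\<close>.\<close>
    have VK: "a \<in> K \<beta> z" if u: "u \<in> V" "a \<in> supp u" for u a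
    proof -
      have ad: "a \<prec>\<^sub>2 d" using Xd V(1) u by blast
      have ex: "\<not> enum d a \<prec>\<^sub>1 x" "enum d a \<prec>\<^sub>1 z"
        using V(3)[OF u] gz underS_trans[OF wo1] by blast+
      have F: "enum d a \<in> Field r1" using enum(2)[OF ad] .
      have "next_closed (F \<beta>) (enum d a) = z"
      proof (rule next_closed_unique[OF FF F z(1) ex(2)])
        fix y assume "closed_under (F \<beta>) y" "enum d a \<prec>\<^sub>1 y"
        then show "\<not> y \<prec>\<^sub>1 z" using z(3) underS_not_le_trans[OF wo1 x(1) _ ex(1)] by blast
      qed
      moreover have "\<not> enum d a \<prec>\<^sub>1 z0"
        using underS_le_trans[OF wo1 _ x(1,2)] ex(1) by blast
      then have "next_closed (F \<beta>) (enum d a) = next_closed (F \<beta>) (enum \<beta> a)"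
        using F_discrepancy[OF \<beta>F d\<beta>] by (intro next_closed_transfer[OF FF z0(1) ed _ d\<beta> ad]) auto
      ultimately show ?thesis using underS_trans[OF wo2 ad d\<beta>] by (simp add: K_def)
    qed
    define T where "T = (\<lambda>y. (y, w y)) ` (supp w - {\<beta>})"
    have DF: "D \<subseteq> carrier R - {\<zero>}" "finite D" using Y by (auto simp: disjoint_family_def)
    have CF: "C \<subseteq> carrier R - {\<zero>}" "finite C" using X by (auto simp: disjoint_family_def)
    have wc: "w y \<in> carrier R" if "y \<in> supp w" for y using wfin(4)[OF that] DF by blast
    have sA: "y \<in> A \<beta> z" if "y \<in> supp w - {\<beta>}" for y
      using m(2)[of "enum \<beta> y"] that mz \<beta>(2) by (auto simp: A_def intro: underS_trans[OF wo1])
    have "T \<in> Fpow (A \<beta> z \<times> carrier R)"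
      using wfin(1) sA wc by (auto simp: T_def Fpow_def)
    then have fF: "comb c \<beta> z T \<in> \<F> c \<beta> z" by (simp add: \<F>_def)
    have f: "comb c \<beta> z T a = (\<Oplus>y\<in>supp w - {\<beta>}. w y \<otimes> c y a)" for a
    proof -
      have rc: "restrict c (A \<beta> z) y a = c y a" if "y \<in> supp w - {\<beta>}" for y
        using sA[OF that] by simp
      have "comb c \<beta> z T a = (\<Oplus>y\<in>supp w - {\<beta>}. snd (y, w y) \<otimes> restrict c (A \<beta> z) (fst (y, w y)) a)"
        unfolding comb_def T_def
      proof (rule finsum_reindex)
        show "(\<lambda>p. snd p \<otimes> restrict c (A \<beta> z) (fst p) a) \<in> (\<lambda>y. (y, w y)) ` (supp w - {\<beta>}) \<rightarrow> carrier R"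
        proof (rule Pi_I)
          fix p assume "p \<in> (\<lambda>y. (y, w y)) ` (supp w - {\<beta>})"
          then obtain y where "y \<in> supp w - {\<beta>}" "p = (y, w y)" by blast
          then show "snd p \<otimes> restrict c (A \<beta> z) (fst p) a \<in> carrier R"
            using rc[of y] wc cc by (simp del: restrict_apply)
        qed
      qed (simp add: inj_on_def)
      also have "\<dots> = (\<Oplus>y\<in>supp w - {\<beta>}. w y \<otimes> c y a)"
        using wc cc rc by (intro finsum_cong') (auto simp del: restrict_apply)
      finally show ?thesis .
    qed
    have "generic \<kappa> (K \<beta> z) (\<F> c \<beta> z) (c \<beta>)" using c[of \<beta>] \<beta>F by (simp add: P_def)
    note gen = this
    \<comment> \<open>\<open>C\<close> contains the values of \<open>u\<close>, and \<open>D\<close>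
      contains the multiplier \<open>w \<beta>\<close> of the top column.\<close>
    have CD: "finite (C \<union> D)" "C \<union> D \<subseteq> carrier R - {\<zero>}" using CF DF by auto
    obtain Z where Z: "|Z| <o \<kappa>" "\<And>S u k. finite S \<Longrightarrow> S \<subseteq> K \<beta> z \<Longrightarrow> \<not> S \<subseteq> Z \<Longrightarrow>
        u \<in> S \<rightarrow> C \<union> D \<Longrightarrow> k \<in> C \<union> D \<Longrightarrow> (\<Oplus>x\<in>S. u x \<otimes> (k \<otimes> c \<beta> x \<oplus> comb c \<beta> z T x)) \<noteq> \<zero>"
      by (rule genericE[OF gen fF CD]) (rule that)
    obtain u where u: "u \<in> V" "supp u \<inter> Z = {}"
      using ordLess_not_family[OF disjoint_family_mono[OF X V(1)] V(2) Z(1)] by blast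
    have ufin: "finite (supp u)" "supp u \<noteq> {}" "\<And>x. x \<in> supp u \<Longrightarrow> u x \<in> C"
      using u(1) V(1) X by (auto simp: disjoint_family_def)
    have uc: "u x \<in> carrier R" if "x \<in> supp u" for x using ufin(3)[OF that] CF by blast
    have "(\<Oplus>p\<in>supp u \<times> supp w. u (fst p) \<otimes> w (snd p) \<otimes> c (snd p) (fst p))
        = (\<Oplus>x\<in>supp u. \<Oplus>y\<in>supp w. u x \<otimes> w y \<otimes> c y x)"
      using ufin wfin uc wc cc by (subst finsum_Times) auto
    also have "\<dots> = (\<Oplus>x\<in>supp u. u x \<otimes> (w \<beta> \<otimes> c \<beta> x \<oplus> comb c \<beta> z T x))"
    proof (rule finsum_cong')
      fix x assume x: "x \<in> supp u"
      have "(\<Oplus>y\<in>supp w. u x \<otimes> w y \<otimes> c y x) = (\<Oplus>y\<in>supp w. u x \<otimes> (w y \<otimes> c y x))"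
        using uc[OF x] wc cc by (intro finsum_cong') (auto simp: m_assoc)
      also have "\<dots> = u x \<otimes> (\<Oplus>y\<in>insert \<beta> (supp w - {\<beta>}). w y \<otimes> c y x)"
        using uc[OF x] wc cc wfin(1) \<beta>(1) by (subst finsum_rdistr) (auto simp: insert_absorb)
      also have "(\<Oplus>y\<in>insert \<beta> (supp w - {\<beta>}). w y \<otimes> c y x)
          = w \<beta> \<otimes> c \<beta> x \<oplus> (\<Oplus>y\<in>supp w - {\<beta>}. w y \<otimes> c y x)"
        using wc cc wfin(1) \<beta>(1) by (intro finsum_insert) auto
      finally show "(\<Oplus>y\<in>supp w. u x \<otimes> w y \<otimes> c y x) = u x \<otimes> (w \<beta> \<otimes> c \<beta> x \<oplus> comb c \<beta> z T x)"
        by (simp add: f)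
    qed (use uc wc cc \<beta>(1) in \<open>auto simp: f intro!: finsum_closed\<close>)
    also have "\<dots> \<noteq> \<zero>"
    proof (rule Z(2))
      show "supp u \<subseteq> K \<beta> z" using VK u(1) by blast
      show "\<not> supp u \<subseteq> Z" using u(2) ufin(2) by blast
    qed (use ufin wfin(4) \<beta>(1) in auto)
    finally show "\<exists>u\<in>X. \<exists>w\<in>Y. (\<Oplus>p\<in>supp u \<times> supp w. u (fst p) \<otimes> w (snd p) \<otimes> c (snd p) (fst p)) \<noteq> \<zero>"
      using u(1) V(1) w(1) by blast
  qed (use cc in auto)
  then show ?thesis by blast
qed

end

section \<open>The dominated case\<close>

context infinite_cardinal
begin

section \<open>Eventually different functions and coherent labels\<close>

definition seg_inj :: "'k set \<Rightarrow> 'k set \<Rightarrow> 'k" where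
  "seg_inj z = (SOME f. inj_on f (underS r1 z) \<and> f ` underS r1 z \<subseteq> Field \<kappa>)"

lemma seg_inj: "inj_on (seg_inj z) (underS r1 z)" "\<And>x. x \<prec>\<^sub>1 z \<Longrightarrow> seg_inj z x \<in> Field \<kappa>"
  using someI_ex[OF exists_inj_Field[OF Card_kappa card_underS1[of z]]]
  unfolding seg_inj_def by auto

lemma card_insert_underS_kappa:
  assumes "x \<in> Field \<kappa>"
  shows "|insert x (underS \<kappa> x)| <o \<kappa>"
proof -
  have "|{x} \<union> underS \<kappa> x| <o \<kappa>"
    by (rule ordLess_Un[OF kappa finite_ordLess_Cinfinite[OF kappa] card_of_underS[OF Card_kappa assms]]) simp
  then show ?thesis by simp
qed

text \<open>At \<open>y\<close> the \<open>i\<close>-th function avoids the values of those earlier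
  \<open>j\<close> whose code \<open>seg_inj i j\<close> is below \<open>y\<close>. These are fewer
  than \<kappa>, so a value is left, and agreement is confined to arguments up to the code. Indices
  are pairs because a row will be identified by its stage and its collapse.\<close>

lemma exists_eventually_different:
  obtains s :: "'k set \<times> 'k set \<Rightarrow> 'k \<Rightarrow> 'k"
  where "\<And>\<rho> y. \<rho> \<in> Field r1 \<times> Field r1 \<Longrightarrow> y \<in> Field \<kappa> \<Longrightarrow> s \<rho> y \<in> Field \<kappa>"
    and "\<And>\<rho> \<rho>'. \<rho> \<in> Field r1 \<times> Field r1 \<Longrightarrow> \<rho>' \<in> Field r1 \<times> Field r1 \<Longrightarrow> \<rho> \<noteq> \<rho>' \<Longrightarrow>
      |{y \<in> Field \<kappa>. s \<rho> y = s \<rho>' y}| <o \<kappa>"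
proof -
  have wo0: "Well_order \<kappa>" using Card_kappa by auto
  define P where "P S i h \<longleftrightarrow> (\<forall>y\<in>Field \<kappa>. h y \<in> Field \<kappa> \<and>
      (\<forall>j. j \<prec>\<^sub>1 i \<longrightarrow> seg_inj i j \<in> underS \<kappa> y \<longrightarrow> h y \<noteq> S j y))"
    for S :: "'k set \<Rightarrow> 'k \<Rightarrow> 'k" and i and h :: "'k \<Rightarrow> 'k"
  have "\<exists>S. \<forall>i. P S i (S i)"
  proof (rule dependent_wf_choice[OF wf_underS[OF wo1]])
    fix S T :: "'k set \<Rightarrow> 'k \<Rightarrow> 'k" and i h
    assume "\<And>z. (z, i) \<in> {(x, y). x \<prec>\<^sub>1 y} \<Longrightarrow> S z = T z"
    then show "P S i h = P T i h" by (simp add: P_def)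
  next
    fix S :: "'k set \<Rightarrow> 'k \<Rightarrow> 'k" and i
    have "\<exists>a. a \<in> Field \<kappa> \<and> (\<forall>j. j \<prec>\<^sub>1 i \<longrightarrow> seg_inj i j \<in> underS \<kappa> y \<longrightarrow> a \<noteq> S j y)"
      if y: "y \<in> Field \<kappa>" for y
    proof -
      let ?J = "{j. j \<prec>\<^sub>1 i \<and> seg_inj i j \<in> underS \<kappa> y}"
      have "|?J| <o \<kappa>"
        using seg_inj(1)[of i]
        by (intro ordLess_inj[OF _ _ card_of_underS[OF Card_kappa y], of "seg_inj i"])
          (auto simp: inj_on_def)
      then have "|(\<lambda>j. S j y) ` ?J| <o \<kappa>" by (rule ordLess_image)
      from ordLess_ex_notin[OF Card_kappa this] show ?thesis by blast
    qed
    then have "\<forall>y\<in>Field \<kappa>. \<exists>a. a \<in> Field \<kappa> \<and>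
      (\<forall>j. j \<prec>\<^sub>1 i \<longrightarrow> seg_inj i j \<in> underS \<kappa> y \<longrightarrow> a \<noteq> S j y)" by blast
    from bchoice[OF this] show "\<exists>h. P S i h" by (simp add: P_def)
  qed
  then obtain S where S: "\<And>i. P S i (S i)" by blast
  have SF: "S i y \<in> Field \<kappa>" if "y \<in> Field \<kappa>" for i y using S[of i] that by (simp add: P_def)
  have less: "|{y \<in> Field \<kappa>. S i y = S j y}| <o \<kappa>" if ij: "j \<prec>\<^sub>1 i" for i j
  proof -
    have F: "seg_inj i j \<in> Field \<kappa>" using seg_inj(2)[OF ij] .
    have "\<not> seg_inj i j \<in> underS \<kappa> y" if "y \<in> Field \<kappa>" "S i y = S j y" for y
      using S[of i] that ij by (auto simp: P_def)
    then have "{y \<in> Field \<kappa>. S i y = S j y} \<subseteq> insert (seg_inj i j) (underS \<kappa> (seg_inj i j))"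
      using underS_linear[OF wo0 F] by blast
    then show ?thesis by (rule ordLess_subset[OF card_insert_underS_kappa[OF F]])
  qed
  have diff: "|{y \<in> Field \<kappa>. S i y = S j y}| <o \<kappa>"
    if "i \<in> Field r1" "j \<in> Field r1" "i \<noteq> j" for i j
  proof -
    have sym: "{y \<in> Field \<kappa>. S i y = S j y} = {y \<in> Field \<kappa>. S j y = S i y}" by auto
    have "i \<prec>\<^sub>1 j \<or> j \<prec>\<^sub>1 i" using underS_linear[OF wo1 that(1,2)] that(3) by blast
    then show ?thesis
    proof
      assume "i \<prec>\<^sub>1 j"
      from less[OF this] show ?thesis by (simp add: sym)
    next
      assume "j \<prec>\<^sub>1 i"
      from less[OF this] show ?thesis .
    qed
  qed
  have "|Field r1| \<le>o r1" by (rule ordIso_imp_ordLeq[OF card_of_Field_ordIso[OF Card_r1]])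
  then have "|Field r1 \<times> Field r1| \<le>o r1" by (intro ordLeq_Times[OF r1])
  then obtain q where q: "inj_on q (Field r1 \<times> Field r1)" "q ` (Field r1 \<times> Field r1) \<subseteq> Field r1"
    using exists_inj_Field[OF Card_r1] by blast
  show thesis
  proof (rule that[of "\<lambda>\<rho>. S (q \<rho>)"])
    fix \<rho> \<rho>' assume \<rho>: "\<rho> \<in> Field r1 \<times> Field r1" "\<rho>' \<in> Field r1 \<times> Field r1" "\<rho> \<noteq> \<rho>'"
    have "q \<rho> \<in> Field r1" "q \<rho>' \<in> Field r1" using q(2) \<rho>(1,2) by auto
    moreover have "q \<rho> \<noteq> q \<rho>'" using inj_onD[OF q(1) _ \<rho>(1,2)] \<rho>(3) by auto
    ultimately show "|{y \<in> Field \<kappa>. S (q \<rho>) y = S (q \<rho>') y}| <o \<kappa>" by (rule diff)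
  qed (rule SF)
qed

text \<open>A substitute for the Mostowski collapse of a small set: injective on the set, and its value
  at a point depends only on the part of the set below that point.\<close>

definition collapse :: "'k set set set \<Rightarrow> 'k set set \<Rightarrow> 'k set" where
  "collapse S = wfrec {(x, y). x \<prec>\<^sub>2 y} (\<lambda>f x. ub (f ` (S \<inter> underS r2 x)))"

lemma collapse_unfold: "collapse S x = ub (collapse S ` (S \<inter> underS r2 x))"
proof -
  have "collapse S x = ub (cut (collapse S) {(x, y). x \<prec>\<^sub>2 y} x ` (S \<inter> underS r2 x))"
    unfolding collapse_def by (rule wfrec[OF wf_underS[OF wo2]])
  also have "cut (collapse S) {(x, y). x \<prec>\<^sub>2 y} x ` (S \<inter> underS r2 x) = collapse S ` (S \<inter> underS r2 x)"
    by (rule image_cong) (auto simp: cut_apply)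
  finally show ?thesis .
qed

lemma collapse_cong:
  assumes "S \<inter> underS r2 x = T \<inter> underS r2 x"
  shows "collapse S x = collapse T x"
  using wf_underS[OF wo2] assms
proof (induction x rule: wf_induct_rule)
  case (less x)
  have "collapse S y = collapse T y" if "y \<in> T \<inter> underS r2 x" for y
  proof (rule less.IH)
    have "underS r2 y \<subseteq> underS r2 x" using that underS_trans[OF wo2, of _ y x] by blast
    then show "S \<inter> underS r2 y = T \<inter> underS r2 y" using less.prems by blast
  qed (use that in auto)
  then have "collapse S ` (S \<inter> underS r2 x) = collapse T ` (T \<inter> underS r2 x)"
    using less.prems by (intro image_cong) auto
  then show ?case using collapse_unfold[of S x] collapse_unfold[of T x] by simp
qed

lemma collapse:
  assumes S: "|S| \<le>o \<kappa>"
  shows "collapse S x \<in> Field r1" "\<And>y. y \<in> S \<Longrightarrow> y \<prec>\<^sub>2 x \<Longrightarrow> collapse S y \<prec>\<^sub>1 collapse S x"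
proof -
  have card: "|collapse S ` (S \<inter> underS r2 x)| \<le>o \<kappa>" for x
    by (rule ordLeq_image[OF ordLeq_subset[OF S]]) blast
  have F: "collapse S x \<in> Field r1" for x
    using wf_underS[OF wo2]
  proof (induction x rule: wf_induct_rule)
    case (less x)
    have "collapse S ` (S \<inter> underS r2 x) \<subseteq> Field r1" using less by auto
    from ub(1)[OF this card] show ?case by (subst collapse_unfold)
  qed
  then show "collapse S x \<in> Field r1" .
  fix y assume "y \<in> S" "y \<prec>\<^sub>2 x"
  then have "collapse S y \<prec>\<^sub>1 ub (collapse S ` (S \<inter> underS r2 x))"
    using F card by (intro ub(2)) auto
  then show "collapse S y \<prec>\<^sub>1 collapse S x" by (simp add: collapse_unfold[of S x])
qed

lemma collapse_neq:
  assumes "|S| \<le>o \<kappa>" "x \<in> S" "y \<in> S" "x \<in> Field r2" "y \<in> Field r2" "x \<noteq> y"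
  shows "collapse S x \<noteq> collapse S y"
  using underS_linear[OF wo2 assms(4,5)] assms(6) collapse(2)[OF assms(1), of x y]
    collapse(2)[OF assms(1), of y x] assms(2,3) by (auto simp: underS_def)

definition below :: "'k set set \<Rightarrow> 'k set \<Rightarrow> 'k set set set" where
  "below b z = {a. a \<prec>\<^sub>2 b \<and> enum b a \<prec>\<^sub>1 z}"

lemma card_below: "|below b z| \<le>o \<kappa>"
  unfolding below_def by (rule card_enum_below)

lemma dominatedE:
  assumes "dominated" "\<And>i x. i \<in> I \<Longrightarrow> x \<in> Field r1 \<Longrightarrow> f i x \<in> Field r1" "|I| \<le>o r2"
  obtains g where "g \<in> Field r1 \<rightarrow> Field r1"
    "\<And>i. i \<in> I \<Longrightarrow> \<exists>t\<in>Field r1. \<forall>x\<in>Field r1. \<not> x \<prec>\<^sub>1 t \<longrightarrow> f i x \<prec>\<^sub>1 g x"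
proof -
  have 1: "f ` I \<subseteq> Field r1 \<rightarrow> Field r1" using assms(2) by blast
  have 2: "|f ` I| \<le>o r2" using assms(3) by (rule ordLeq_image)
  have "\<exists>g\<in>Field r1 \<rightarrow> Field r1. \<forall>h\<in>f ` I. \<exists>t\<in>Field r1. \<forall>x\<in>Field r1. \<not> x \<prec>\<^sub>1 t \<longrightarrow> h x \<prec>\<^sub>1 g x"
    using assms(1)[unfolded dominated_def, THEN spec, THEN mp, THEN mp, OF 1 2] .
  then obtain g where "g \<in> Field r1 \<rightarrow> Field r1"
    "\<forall>h\<in>f ` I. \<exists>t\<in>Field r1. \<forall>x\<in>Field r1. \<not> x \<prec>\<^sub>1 t \<longrightarrow> h x \<prec>\<^sub>1 g x" by (rule bexE)
  then show thesis by (intro that[of g]) simp_all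
qed

end

context infinite_field
begin

text \<open>One \<open>g\<close> dominates all discrepancies, so its closed points serve all
  columns. Relative to a \<beta> above \<kappa> many vectors of \<open>Y\<close>, all labels are
  read off the sets \<open>below \<beta> z\<close>. For suitable \<open>u\<close> and
  \<open>w\<close> the pairs from the two supports then receive distinct positions in
  \<open>Field \<kappa> \<times> Field \<kappa>\<close>, where a single generic function is
  evaluated.\<close>

lemma exists_gross_coefficients_dominated:
  assumes dom: "dominated"
  shows "\<exists>c. gross_coefficients c"
proof -
  have F2: "|Field r2| \<le>o r2" by (rule ordIso_imp_ordLeq[OF card_of_Field_ordIso[OF Card_r2]])
  have F0: "|Field \<kappa>| \<le>o \<kappa>" by (rule ordIso_imp_ordLeq[OF card_of_Field_ordIso[OF Card_kappa]])
  have "|{p. fst p \<prec>\<^sub>2 snd p}| \<le>o r2"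
    by (rule ordLeq_subset[OF ordLeq_Times[OF r2 F2 F2]]) (auto dest: underS_in_Field)
  then obtain g where g: "g \<in> Field r1 \<rightarrow> Field r1" and gd: "\<And>p. p \<in> {p. fst p \<prec>\<^sub>2 snd p} \<Longrightarrow>
      \<exists>t\<in>Field r1. \<forall>x\<in>Field r1. \<not> x \<prec>\<^sub>1 t \<longrightarrow> discrepancy (fst p) (snd p) x \<prec>\<^sub>1 g x"
    using dominatedE[OF dom, of "{p. fst p \<prec>\<^sub>2 snd p}" "\<lambda>p. discrepancy (fst p) (snd p)"] discrepancy(1) by auto
  \<comment> \<open>\<open>bb z\<close> eventually bounds the collapse of each column index. Hence
    one injection \<open>seg_inj (bb z)\<close> per stage turns these collapses into labels in
    \<kappa>, and distinct columns keep distinct labels.\<close>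
  obtain bb where bb: "bb \<in> Field r1 \<rightarrow> Field r1" and bbd: "\<And>b. b \<in> Field r2 \<Longrightarrow>
      \<exists>t\<in>Field r1. \<forall>z\<in>Field r1. \<not> z \<prec>\<^sub>1 t \<longrightarrow> collapse (below b z) b \<prec>\<^sub>1 bb z"
    using dominatedE[OF dom _ F2, of "\<lambda>b z. collapse (below b z) b"] collapse(1)[OF card_below] by auto
  obtain s where sF: "\<And>\<rho> y. \<rho> \<in> Field r1 \<times> Field r1 \<Longrightarrow> y \<in> Field \<kappa> \<Longrightarrow> s \<rho> y \<in> Field \<kappa>"
    and s: "\<And>\<rho> \<rho>'. \<rho> \<in> Field r1 \<times> Field r1 \<Longrightarrow> \<rho>' \<in> Field r1 \<times> Field r1 \<Longrightarrow> \<rho> \<noteq> \<rho>' \<Longrightarrow>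
      |{y \<in> Field \<kappa>. s \<rho> y = s \<rho>' y}| <o \<kappa>"
    using exists_eventually_different by blast
  have "|{\<lambda>_::'k \<times> 'k. \<zero>}| \<le>o \<kappa>"
    by (rule ordLess_imp_ordLeq[OF finite_ordLess_Cinfinite[OF kappa]]) simp
  from exists_generic_function[OF kappa card_carrier ordLeq_Times[OF kappa F0 F0] this]
  obtain \<theta> where \<theta>: "\<And>n. \<theta> n \<in> carrier R" "generic \<kappa> (Field \<kappa> \<times> Field \<kappa>) {\<lambda>_. \<zero>} \<theta>"
    by auto
  define label where "label S z b = seg_inj (bb z) (collapse S b)" for S z b
  \<comment> \<open>The stage and the collapse of \<open>a\<close> select one of the eventually
    different functions. Keeping the label as second coordinate makes a coincidence of two nodes
    force agreement of the selected functions at that label.\<close>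
  define node where "node S z a b = (s (z, collapse S a) (label S z b), label S z b)" for S z a b
  define c where "c a b = (let z = next_closed g (enum b a) in \<theta> (node (below b z) z a b))" for a b
  have cc: "c a b \<in> carrier R" for a b using \<theta>(1) by (simp add: c_def Let_def)
  have "gross_coefficients c"
    unfolding gross_coefficients_def
  proof (intro conjI allI impI)
    fix X Y C D d
    assume X: "disjoint_family X C" and Y: "disjoint_family Y D"
      and cX: "\<not> |X| \<le>o \<kappa>" and cY: "\<not> |Y| \<le>o r1" and d: "d \<in> Field r2"
      and Xd: "\<forall>u\<in>X. \<forall>x\<in>supp u. x \<prec>\<^sub>2 d" and Yd: "\<forall>w\<in>Y. \<forall>y\<in>supp w. d \<prec>\<^sub>2 y"
    have "\<not> |Y| \<le>o \<kappa>" using cY kappa_le_r1 by blast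
    then obtain V where V: "V \<subseteq> Y" "|V| =o \<kappa>" by (rule not_ordLeq_kappa)
    note VD = disjoint_family_mono[OF Y V(1)]
    define B where "B = (\<Union>w\<in>V. supp w)"
    have Bc: "|B| \<le>o \<kappa>" unfolding B_def
    proof (rule ordLeq_UN[OF kappa ordIso_imp_ordLeq[OF V(2)]])
      fix w assume "w \<in> V"
      then have "finite (supp w)" using VD by (simp add: disjoint_family_def)
      then show "|supp w| \<le>o \<kappa>"
        by (rule ordLess_imp_ordLeq[OF finite_ordLess_Cinfinite[OF kappa]])
    qed
    have BF: "B \<subseteq> Field r2" using VD unfolding B_def disjoint_family_def by blast
    have dB: "d \<prec>\<^sub>2 b" if "b \<in> B" for b using that Yd V(1) unfolding B_def by blast
    \<comment> \<open>A common reference point above all columns in question; it exists because only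
      \<kappa> vectors of \<open>Y\<close> were kept.\<close>
    obtain \<beta> where \<beta>: "\<beta> \<in> Field r2" "B \<subseteq> underS r2 \<beta>"
      using ex_above_underS[OF r1 BF kappa_le_r1[OF Bc]] by blast
    have "\<forall>b\<in>B. \<exists>t. t \<in> Field r1 \<and> (\<forall>x\<in>Field r1. \<not> x \<prec>\<^sub>1 t \<longrightarrow> discrepancy b \<beta> x \<prec>\<^sub>1 g x)"
    proof
      fix b assume "b \<in> B"
      then show "\<exists>t. t \<in> Field r1 \<and> (\<forall>x\<in>Field r1. \<not> x \<prec>\<^sub>1 t \<longrightarrow> discrepancy b \<beta> x \<prec>\<^sub>1 g x)"
        using gd[of "(b, \<beta>)"] \<beta>(2) by auto
    qed
    from bchoice[OF this] obtain tc where tc: "\<And>b. b \<in> B \<Longrightarrow> tc b \<in> Field r1"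
      "\<And>b x. b \<in> B \<Longrightarrow> x \<in> Field r1 \<Longrightarrow> \<not> x \<prec>\<^sub>1 tc b \<Longrightarrow> discrepancy b \<beta> x \<prec>\<^sub>1 g x" by auto
    have "\<forall>b\<in>B. \<exists>t. t \<in> Field r1 \<and> (\<forall>z\<in>Field r1. \<not> z \<prec>\<^sub>1 t \<longrightarrow> collapse (below b z) b \<prec>\<^sub>1 bb z)"
    proof
      fix b assume "b \<in> B"
      then show "\<exists>t. t \<in> Field r1 \<and> (\<forall>z\<in>Field r1. \<not> z \<prec>\<^sub>1 t \<longrightarrow> collapse (below b z) b \<prec>\<^sub>1 bb z)"
        using bbd[of b] BF by auto
    qed
    from bchoice[OF this] obtain tb where tb: "\<And>b. b \<in> B \<Longrightarrow> tb b \<in> Field r1"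
      "\<And>b z. b \<in> B \<Longrightarrow> z \<in> Field r1 \<Longrightarrow> \<not> z \<prec>\<^sub>1 tb b \<Longrightarrow> collapse (below b z) b \<prec>\<^sub>1 bb z" by auto
    \<comment> \<open>Beyond \<tau>, closed points cut each \<open>b\<close> in \<open>B\<close> as
      they cut \<beta>, lie above \<open>enum \<beta> b\<close>, and satisfy the bound
      \<open>bb\<close>. At most \<kappa> thresholds have a common bound in
      \<open>r1\<close>.\<close>
    define \<tau> where "\<tau> = ub (tc ` B \<union> (tb ` B \<union> enum \<beta> ` B))"
    have ubF: "tc ` B \<union> (tb ` B \<union> enum \<beta> ` B) \<subseteq> Field r1" using tc(1) tb(1) enum(2) \<beta>(2) by blast
    have "|tc ` B \<union> (tb ` B \<union> enum \<beta> ` B)| \<le>o \<kappa>"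
      by (intro ordLeq_Un[OF kappa] ordLeq_image[OF Bc])
    note \<tau> = ub[OF ubF this, folded \<tau>_def]
    define \<tau>0 where "\<tau>0 = next_closed g \<tau>"
    note \<tau>0 = next_closed[OF g \<tau>(1), folded \<tau>0_def]
    have tc\<tau>: "tc b \<prec>\<^sub>1 z" and tb\<tau>: "tb b \<prec>\<^sub>1 z" and en\<tau>: "enum \<beta> b \<prec>\<^sub>1 z"
      if "b \<in> B" "\<tau> \<prec>\<^sub>1 z" for b z
      using that \<tau>(2) by (auto intro: underS_trans[OF wo1 _ that(2)])
    have F1: "below b z = below \<beta> z \<inter> underS r2 b" and F2: "b \<in> below \<beta> z"
      and F3: "collapse (below b z) b \<prec>\<^sub>1 bb z"
      if b: "b \<in> B" and z: "closed_under g z" "\<tau> \<prec>\<^sub>1 z" for b z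
    proof -
      have b\<beta>: "b \<prec>\<^sub>2 \<beta>" using b \<beta>(2) by blast
      have "enum b a \<prec>\<^sub>1 z \<longleftrightarrow> enum \<beta> a \<prec>\<^sub>1 z" if "a \<prec>\<^sub>2 b" for a
        using enum_transfer[OF z(1) tc\<tau>[OF b z(2)] tc(2)[OF b] b\<beta> that] by blast
      then show "below b z = below \<beta> z \<inter> underS r2 b"
        using underS_trans[OF wo2 _ b\<beta>] by (auto simp: below_def)
      show "b \<in> below \<beta> z" using b\<beta> en\<tau>[OF b z(2)] by (simp add: below_def)
      have "\<not> z \<prec>\<^sub>1 tb b"
        using underS_trans[OF wo1 tb\<tau>[OF b z(2)], of "tb b"] by (auto simp: underS_notIn)
      then show "collapse (below b z) b \<prec>\<^sub>1 bb z"
        using tb(2)[OF b] z(1) by (simp add: closed_under_def)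
    qed
    \<comment> \<open>No support point of \<open>u\<close> is enumerated at \<beta> before
      \<open>\<tau>0\<close>, so the stages of all its rows lie beyond \<tau>.\<close>
    obtain u where u: "u \<in> X" "supp u \<inter> below \<beta> \<tau>0 = {}"
      using not_ordLeq_ex[OF family_avoiding[OF X kappa cX card_below] kappa] by blast
    have ufin: "finite (supp u)" "supp u \<noteq> {}" "\<And>x. x \<in> supp u \<Longrightarrow> u x \<in> C"
      using u(1) X by (auto simp: disjoint_family_def)
    have aF: "a \<in> Field r2" if "a \<in> supp u" for a
      using that u(1) X by (auto simp: disjoint_family_def)
    have ab: "a \<prec>\<^sub>2 b" if "a \<in> supp u" "b \<in> B" for a b
      using underS_trans[OF wo2 _ dB[OF that(2)]] Xd u(1) that(1) by blast
    have "\<exists>b. b \<in> B"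
    proof -
      have "\<exists>w. w \<in> V"
      proof (rule ccontr)
        assume "\<not> ?thesis"
        then have "V = {}" by auto
        then have "|V| <o \<kappa>" using finite_ordLess_Cinfinite[OF kappa, of V] by simp
        then show False using V(2) not_ordLess_ordIso[of "|V|" \<kappa>] by simp
      qed
      then show ?thesis using VD unfolding B_def disjoint_family_def by blast
    qed
    then obtain b0 where b0: "b0 \<in> B" by blast
    have a\<beta>: "a \<prec>\<^sub>2 \<beta>" if "a \<in> supp u" for a
      using underS_trans[OF wo2 ab[OF that b0]] \<beta>(2) b0 by blast
    define zz where "zz a = next_closed g (enum \<beta> a)" for a
    define S where "S a = below \<beta> (zz a)" for a
    have zz: "closed_under g (zz a)" "enum \<beta> a \<prec>\<^sub>1 zz a" "\<tau> \<prec>\<^sub>1 zz a" "zz a \<in> Field r1"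
      and nz: "\<not> enum \<beta> a \<prec>\<^sub>1 \<tau>0" if a: "a \<in> supp u" for a
    proof -
      have F: "enum \<beta> a \<in> Field r1" using enum(2)[OF a\<beta>[OF a]] .
      show 1: "closed_under g (zz a)" "enum \<beta> a \<prec>\<^sub>1 zz a" "zz a \<in> Field r1"
        unfolding zz_def using next_closed[OF g F] by blast+
      show 2: "\<not> enum \<beta> a \<prec>\<^sub>1 \<tau>0" using u(2) a a\<beta>[OF a] by (auto simp: below_def)
      show "\<tau> \<prec>\<^sub>1 zz a"
        using underS_trans[OF wo1 underS_le_trans[OF wo1 \<tau>0(2) F 2] 1(2)] .
    qed
    have Sa: "a \<in> S a" if "a \<in> supp u" for a
      using a\<beta>[OF that] zz(2)[OF that] by (simp add: S_def below_def)
    have Sc: "|S a| \<le>o \<kappa>" for a unfolding S_def by (rule card_below)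
    \<comment> \<open>The entry, defined through \<open>b\<close>, is recomputed through \<beta>:
      the stage transfers, and \<open>below b (zz a)\<close> is the part of \<open>S a\<close> below
      \<open>b\<close>, which is all that the collapses of \<open>a\<close> and \<open>b\<close>
      depend on.\<close>
    have cval: "c a b = \<theta> (node (S a) (zz a) a b)" if a: "a \<in> supp u" and b: "b \<in> B" for a b
    proof -
      have b\<beta>: "b \<prec>\<^sub>2 \<beta>" using b \<beta>(2) by blast
      have "next_closed g (enum b a) = zz a" unfolding zz_def
        using nz[OF a] by (intro next_closed_transfer[OF g \<tau>0(1) tc\<tau>[OF b \<tau>0(2)] tc(2)[OF b] b\<beta> ab[OF a b]]) auto
      moreover have bl: "below b (zz a) = S a \<inter> underS r2 b"
        unfolding S_def by (rule F1[OF b zz(1,3)[OF a]])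
      have "underS r2 a \<subseteq> underS r2 b" using underS_trans[OF wo2 _ ab[OF a b]] by blast
      then have "collapse (below b (zz a)) a = collapse (S a) a"
        by (intro collapse_cong) (auto simp: bl)
      moreover have "collapse (below b (zz a)) b = collapse (S a) b"
        by (intro collapse_cong) (auto simp: bl)
      ultimately show ?thesis by (simp add: c_def Let_def node_def label_def)
    qed
    have Sb: "b \<in> S a" and Sbb: "collapse (S a) b \<prec>\<^sub>1 bb (zz a)" if a: "a \<in> supp u" and b: "b \<in> B" for a b
    proof -
      show "b \<in> S a" unfolding S_def by (rule F2[OF b zz(1,3)[OF a]])
      have "below b (zz a) = S a \<inter> underS r2 b"
        unfolding S_def by (rule F1[OF b zz(1,3)[OF a]])
      then have "collapse (below b (zz a)) b = collapse (S a) b"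
        by (intro collapse_cong) auto
      then show "collapse (S a) b \<prec>\<^sub>1 bb (zz a)" using F3[OF b zz(1,3)[OF a]] by simp
    qed
    define y where "y a b = label (S a) (zz a) b" for a b
    define \<rho> where "\<rho> a = (zz a, collapse (S a) a)" for a
    have \<rho>F: "\<rho> a \<in> Field r1 \<times> Field r1" if "a \<in> supp u" for a
      using zz(4)[OF that] collapse(1)[OF Sc] by (simp add: \<rho>_def)
    \<comment> \<open>Equal stages give the same set \<open>S a\<close>, on which the collapse is
      injective.\<close>
    have \<rho>n: "\<rho> a \<noteq> \<rho> a'" if "a \<in> supp u" "a' \<in> supp u" "a \<noteq> a'" for a a'
    proof
      assume "\<rho> a = \<rho> a'"
      then have "zz a = zz a'" "collapse (S a) a = collapse (S a') a'" by (simp_all add: \<rho>_def)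
      moreover from this have "S a' = S a" by (simp add: S_def)
      ultimately show False
        using collapse_neq[OF Sc[of a] Sa _ aF aF that(3)] Sa[of a'] that by simp
    qed
    have yF: "y a b \<in> Field \<kappa>" if "a \<in> supp u" "b \<in> B" for a b
      unfolding y_def label_def using seg_inj(2)[OF Sbb[OF that]] .
    have yinj: "inj_on (y a) B" if a: "a \<in> supp u" for a
    proof (rule inj_onI, rule ccontr)
      fix b b' assume b: "b \<in> B" "b' \<in> B" "y a b = y a b'" "b \<noteq> b'"
      then have "collapse (S a) b = collapse (S a) b'"
        using inj_onD[OF seg_inj(1)[of "bb (zz a)"]] Sbb[OF a] by (simp add: y_def label_def)
      then show False
        using collapse_neq[OF Sc[of a] Sb[OF a b(1)] Sb[OF a b(2)] _ _ b(4)] b BF by blast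
    qed
    \<comment> \<open>The products are the coefficients of the double sum; \<one> is the multiplier
      with which \<theta> occurs in it.\<close>
    define E where "E = insert \<one> ((\<lambda>p. fst p \<otimes> snd p) ` (C \<times> D))"
    have CD: "finite C" "C \<subseteq> carrier R - {\<zero>}" "finite D" "D \<subseteq> carrier R - {\<zero>}"
      using X Y by (auto simp: disjoint_family_def)
    have prod: "p \<otimes> q \<in> carrier R - {\<zero>}" if "p \<in> C" "q \<in> D" for p q
    proof -
      have "p \<in> carrier R" "q \<in> carrier R" "p \<noteq> \<zero>" "q \<noteq> \<zero>" using that CD by auto
      then show ?thesis using integral_iff by simp
    qed
    have E: "finite E" "E \<subseteq> carrier R - {\<zero>}"
      using CD(1,3) prod by (auto simp: E_def)
    obtain Z where Z: "|Z| <o \<kappa>" "\<And>S u k. finite S \<Longrightarrow> S \<subseteq> Field \<kappa> \<times> Field \<kappa> \<Longrightarrow> \<not> S \<subseteq> Z \<Longrightarrow>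
        u \<in> S \<rightarrow> E \<Longrightarrow> k \<in> E \<Longrightarrow> (\<Oplus>x\<in>S. u x \<otimes> (k \<otimes> \<theta> x \<oplus> \<zero>)) \<noteq> \<zero>"
      by (rule genericE[OF \<theta>(2) singletonI E]) (rule that)
    \<comment> \<open>Labels to avoid: those occurring in \<open>Z\<close>, and those at which the
      functions of two distinct rows of \<open>u\<close> agree. They are fewer than \<kappa>; since
      labels are injective in \<open>b\<close> for each row, fewer than \<kappa> columns are
      \<open>Bad\<close>, and some \<open>w\<close> avoids them.\<close>
    define Y1 where "Y1 = snd ` Z \<union> (\<Union>p\<in>{p \<in> supp u \<times> supp u. fst p \<noteq> snd p}.
      {n \<in> Field \<kappa>. s (\<rho> (fst p)) n = s (\<rho> (snd p)) n})"
    have Y1: "|Y1| <o \<kappa>" unfolding Y1_def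
    proof (intro ordLess_Un[OF kappa] ordLess_image[OF Z(1)] ordLess_UN_finite[OF kappa])
      show "finite {p \<in> supp u \<times> supp u. fst p \<noteq> snd p}" using ufin(1) by auto
      fix p assume "p \<in> {p \<in> supp u \<times> supp u. fst p \<noteq> snd p}"
      then have p: "fst p \<in> supp u" "snd p \<in> supp u" "fst p \<noteq> snd p" by auto
      show "|{n \<in> Field \<kappa>. s (\<rho> (fst p)) n = s (\<rho> (snd p)) n}| <o \<kappa>"
        by (rule s[OF \<rho>F[OF p(1)] \<rho>F[OF p(2)] \<rho>n[OF p]])
    qed
    define Bad where "Bad = (\<Union>a\<in>supp u. {b \<in> B. y a b \<in> Y1})"
    have "|Bad| <o \<kappa>" unfolding Bad_def
    proof (rule ordLess_UN_finite[OF kappa ufin(1)])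
      fix a assume "a \<in> supp u"
      then show "|{b \<in> B. y a b \<in> Y1}| <o \<kappa>"
        using yinj[of a] by (intro ordLess_inj[OF _ _ Y1, of "y a"]) (auto simp: inj_on_def)
    qed
    from ordLess_not_family[OF VD V(2) this] obtain w
      where w: "w \<in> V" "supp w \<inter> Bad = {}" by blast
    have wfin: "finite (supp w)" "supp w \<noteq> {}" "\<And>x. x \<in> supp w \<Longrightarrow> w x \<in> D"
      using w(1) VD by (auto simp: disjoint_family_def)
    have wB: "b \<in> B" if "b \<in> supp w" for b using that w(1) by (auto simp: B_def)
    have wY1: "y a b \<notin> Y1" if "a \<in> supp u" "b \<in> supp w" for a b
      using w(2) wB that by (auto simp: Bad_def)
    define nd where "nd p = (s (\<rho> (fst p)) (y (fst p) (snd p)), y (fst p) (snd p))" for p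
    \<comment> \<open>Equal nodes have equal labels. Distinct rows would put that label into
      \<open>Y1\<close>, so the rows are equal, and then injectivity of the labels gives equal
      columns.\<close>
    have ndinj: "inj_on nd (supp u \<times> supp w)"
    proof (rule inj_onI)
      fix p q assume p: "p \<in> supp u \<times> supp w" and q: "q \<in> supp u \<times> supp w" and eq: "nd p = nd q"
      have y: "y (fst p) (snd p) = y (fst q) (snd q)" using eq by (simp add: nd_def)
      have f: "fst p = fst q"
      proof (rule ccontr)
        assume ne: "fst p \<noteq> fst q"
        have "s (\<rho> (fst p)) (y (fst p) (snd p)) = s (\<rho> (fst q)) (y (fst p) (snd p))"
          using eq y by (simp add: nd_def)
        then have "y (fst p) (snd p) \<in> Y1"
          using p q ne yF[of "fst p" "snd p"] wB[of "snd p"] unfolding Y1_def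
          by (intro UnI2 UN_I[of "(fst p, fst q)"]) auto
        then show False using wY1[of "fst p" "snd p"] p by auto
      qed
      moreover have "snd p = snd q"
        using inj_onD[OF yinj[of "fst p"], of "snd p" "snd q"] y f p q wB by auto
      ultimately show "p = q" by (rule prod_eqI)
    qed
    define N where "N = nd ` (supp u \<times> supp w)"
    define u' where "u' n = (let p = the_inv_into (supp u \<times> supp w) nd n in u (fst p) \<otimes> w (snd p))" for n
    have u': "u' (nd p) = u (fst p) \<otimes> w (snd p)" if "p \<in> supp u \<times> supp w" for p
      using the_inv_into_f_f[OF ndinj that] by (simp add: u'_def)
    have uwE: "u (fst p) \<otimes> w (snd p) \<in> E" if "p \<in> supp u \<times> supp w" for p
    proof -
      have "(u (fst p), w (snd p)) \<in> C \<times> D" using that ufin(3) wfin(3) by auto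
      then show ?thesis unfolding E_def by (intro insertI2) (auto intro: rev_image_eqI)
    qed
    have Ec: "x \<in> carrier R" if "x \<in> E" for x using that E(2) by blast
    have ndc: "node (S (fst p)) (zz (fst p)) (fst p) (snd p) = nd p" for p
      by (simp add: node_def nd_def \<rho>_def y_def)
    have "(\<Oplus>p\<in>supp u \<times> supp w. u (fst p) \<otimes> w (snd p) \<otimes> c (fst p) (snd p))
        = (\<Oplus>p\<in>supp u \<times> supp w. u' (nd p) \<otimes> (\<one> \<otimes> \<theta> (nd p) \<oplus> \<zero>))"
    proof (rule finsum_cong')
      fix p assume p: "p \<in> supp u \<times> supp w"
      then have "c (fst p) (snd p) = \<theta> (nd p)"
        using cval[of "fst p" "snd p"] wB ndc[of p] by auto
      then show "u (fst p) \<otimes> w (snd p) \<otimes> c (fst p) (snd p) = u' (nd p) \<otimes> (\<one> \<otimes> \<theta> (nd p) \<oplus> \<zero>)"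
        using u'[OF p] \<theta>(1) by simp
    qed (use u' uwE Ec \<theta>(1) in auto)
    also have "\<dots> = (\<Oplus>n\<in>N. u' n \<otimes> (\<one> \<otimes> \<theta> n \<oplus> \<zero>))"
      unfolding N_def
    proof (rule finsum_reindex[symmetric])
      show "(\<lambda>n. u' n \<otimes> (\<one> \<otimes> \<theta> n \<oplus> \<zero>)) \<in> nd ` (supp u \<times> supp w) \<rightarrow> carrier R"
      proof (rule Pi_I)
        fix n assume "n \<in> nd ` (supp u \<times> supp w)"
        then obtain p where "p \<in> supp u \<times> supp w" "n = nd p" by blast
        then show "u' n \<otimes> (\<one> \<otimes> \<theta> n \<oplus> \<zero>) \<in> carrier R" using u' uwE Ec \<theta>(1) by simp
      qed
    qed (rule ndinj)
    also have "\<dots> \<noteq> \<zero>"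
    proof (rule Z(2))
      show "finite N" using ufin(1) wfin(1) by (simp add: N_def)
      show "N \<subseteq> Field \<kappa> \<times> Field \<kappa>"
      proof
        fix n assume "n \<in> N"
        then obtain p where p: "p \<in> supp u \<times> supp w" "n = nd p" by (auto simp: N_def)
        then have "y (fst p) (snd p) \<in> Field \<kappa>" using yF wB by auto
        then show "n \<in> Field \<kappa> \<times> Field \<kappa>"
          using sF[OF \<rho>F[of "fst p"]] p by (auto simp: nd_def)
      qed
      show "\<not> N \<subseteq> Z"
      proof
        assume NZ: "N \<subseteq> Z"
        obtain a b where ab: "a \<in> supp u" "b \<in> supp w" using ufin(2) wfin(2) by blast
        then have "nd (a, b) \<in> Z" using NZ by (auto simp: N_def)
        then have "y a b \<in> Y1" unfolding Y1_def
          by (intro UnI1) (auto intro: rev_image_eqI simp: nd_def)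
        then show False using wY1[OF ab] by simp
      qed
      show "u' \<in> N \<rightarrow> E"
      proof (rule Pi_I)
        fix n assume "n \<in> N"
        then obtain p where p: "p \<in> supp u \<times> supp w" "n = nd p" by (auto simp: N_def)
        then show "u' n \<in> E" using u' uwE by simp
      qed
      show "\<one> \<in> E" by (simp add: E_def)
    qed
    finally show "\<exists>u\<in>X. \<exists>w\<in>Y. (\<Oplus>p\<in>supp u \<times> supp w. u (fst p) \<otimes> w (snd p) \<otimes> c (fst p) (snd p)) \<noteq> \<zero>"
      using u(1) V(1) w(1) by blast
  qed (rule cc)
  then show ?thesis by blast
qed

lemma exists_gross_coefficients: "\<exists>c. gross_coefficients c"
  using exists_gross_coefficients_dominated exists_gross_coefficients_unbounded by blast

end

section \<open>Dimensions and the form\<close>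

context vectorspace
begin

text \<open>Zorn's lemma: a linear dependence involves finitely many vectors, which all lie in one
  member of a chain.\<close>

lemma basis_exists: "\<exists>B. basis B"
proof -
  let ?A = "{S. S \<subseteq> carrier V \<and> lin_indpt S}"
  have "\<exists>M\<in>?A. \<forall>X\<in>?A. M \<subseteq> X \<longrightarrow> X = M"
  proof (rule subset_Zorn_nonempty)
    have "lin_indpt {}" unfolding lin_dep_def by auto
    then show "?A \<noteq> {}" by blast
  next
    fix \<C> assume C: "\<C> \<noteq> {}" "subset.chain ?A \<C>"
    have sub: "S \<in> \<C> \<Longrightarrow> S \<subseteq> carrier V \<and> lin_indpt S" for S
      using C(2) unfolding subset.chain_def by blast
    have "lin_indpt (\<Union>\<C>)"
    proof
      assume "lin_dep (\<Union>\<C>)"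
      then obtain A a v where A: "finite A" "A \<subseteq> \<Union>\<C>" "a \<in> A \<rightarrow> carrier K"
          "lincomb a A = \<zero>\<^bsub>V\<^esub>" "v \<in> A" "a v \<noteq> \<zero>\<^bsub>K\<^esub>"
        unfolding lin_dep_def by blast
      obtain S where S: "S \<in> \<C>" "A \<subseteq> S"
        using finite_subset_Union_chain[OF A(1,2) C] by blast
      then have "lin_dep S" using A unfolding lin_dep_def by blast
      then show False using sub[OF S(1)] by blast
    qed
    then show "\<Union>\<C> \<in> ?A" using sub by blast
  qed
  then obtain M where "M \<in> ?A" "\<forall>X\<in>?A. M \<subseteq> X \<longrightarrow> X = M" by blast
  then have "maximal M (\<lambda>S. S \<subseteq> carrier V \<and> lin_indpt S)" unfolding maximal_def by blast
  then show ?thesis using max_li_is_basis by blast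
qed

lemma cdim_basis: obtains B where "basis B" "cdim = |B|"
  using someI_ex[OF basis_exists] unfolding cdim_def by blast

lemma cdim_ordLeq_carrier: "cdim \<le>o |carrier V|"
proof -
  obtain B where "basis B" "cdim = |B|" by (rule cdim_basis)
  then show ?thesis using card_of_mono1[of B "carrier V"] by (simp add: basis_def)
qed

text \<open>Every vector is determined by a finite set of pairs of a basis vector and a coefficient.
  With \<open>cdim_ordLeq_carrier\<close> this translates between dimension and number of vectors
  over a field of size at most \<mu>.\<close>

lemma carrier_ordLeq:
  assumes \<mu>: "Cinfinite \<mu>" and K: "|carrier K| \<le>o \<mu>" and dim: "cdim \<le>o \<mu>"
  shows "|carrier V| \<le>o \<mu>"
proof -
  obtain B where B: "basis B" "cdim = |B|" by (rule cdim_basis)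
  have BV: "B \<subseteq> carrier V" "span B = carrier V" using B(1) by (auto simp: basis_def)
  define f where "f T = (\<Oplus>\<^bsub>V\<^esub>p\<in>T. snd p \<odot>\<^bsub>V\<^esub> fst p)" for T
  have "carrier V \<subseteq> f ` Fpow (B \<times> carrier K)"
  proof
    fix v assume "v \<in> carrier V"
    then have "v \<in> span B" using BV(2) by simp
    then obtain a A where A: "finite A" "A \<subseteq> B" "a \<in> A \<rightarrow> carrier K" "v = lincomb a A"
      unfolding span_def by auto
    define T where "T = (\<lambda>x. (x, a x)) ` A"
    have "f T = (\<Oplus>\<^bsub>V\<^esub>x\<in>A. snd (x, a x) \<odot>\<^bsub>V\<^esub> fst (x, a x))"
      unfolding f_def T_def
    proof (rule M.finsum_reindex)
      show "(\<lambda>p. snd p \<odot>\<^bsub>V\<^esub> fst p) \<in> (\<lambda>x. (x, a x)) ` A \<rightarrow> carrier V"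
      proof (rule Pi_I)
        fix p assume "p \<in> (\<lambda>x. (x, a x)) ` A"
        then obtain x where x: "x \<in> A" "p = (x, a x)" by blast
        then have "x \<in> carrier V" "a x \<in> carrier K" using A(2,3) BV(1) by auto
        then show "snd p \<odot>\<^bsub>V\<^esub> fst p \<in> carrier V" using x(2) by simp
      qed
    qed (simp add: inj_on_def)
    then have "v = f T" using A(4) by (simp add: lincomb_def)
    moreover have "T \<in> Fpow (B \<times> carrier K)" using A by (auto simp: T_def Fpow_def)
    ultimately show "v \<in> f ` Fpow (B \<times> carrier K)" by blast
  qed
  moreover have "|f ` Fpow (B \<times> carrier K)| \<le>o \<mu>"
    using dim B(2) K by (intro ordLeq_image ordLeq_Fpow[OF \<mu>] ordLeq_Times[OF \<mu>]) simp_all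
  ultimately show ?thesis by (rule ordLeq_subset[rotated])
qed

end

context infinite_field
begin

section \<open>Finitely supported functions and the extraction of disjoint families\<close>

definition vec :: "('k set set \<Rightarrow> 'a) set" where
  "vec = {v. (\<forall>x. v x \<in> carrier R) \<and> finite (supp v) \<and> supp v \<subseteq> Field r2}"

lemma vecD: "v \<in> vec \<Longrightarrow> v x \<in> carrier R" "v \<in> vec \<Longrightarrow> finite (supp v)"
    "v \<in> vec \<Longrightarrow> supp v \<subseteq> Field r2"
  by (simp_all add: vec_def)

text \<open>Take a maximal disjoint subfamily \<open>M\<close> of nonzero elements. If it had size
  at most \<mu>, so would the union \<open>V\<close> of its supports. Two elements of
  \<open>U\<close> agreeing on \<open>V\<close> have a difference with support off \<open>V\<close>,
  which is zero by maximality; so \<open>U\<close> would embed into the finite partial functions on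
  \<open>V\<close>. Hence \<open>M\<close> is large, and the pigeonhole principle fixes the set of
  coefficients.\<close>

lemma extract_disjoint_family:
  assumes U: "U \<subseteq> vec" and diff: "\<And>v w. v \<in> U \<Longrightarrow> w \<in> U \<Longrightarrow> (\<lambda>x. v x \<ominus> w x) \<in> U"
    and \<mu>: "Cinfinite \<mu>" and R: "|carrier R| \<le>o \<mu>" and card: "\<not> |U| \<le>o \<mu>"
  obtains X C where "X \<subseteq> U" "disjoint_family X C" "\<not> |X| \<le>o \<mu>"
proof -
  let ?A = "{X. X \<subseteq> {v \<in> U. supp v \<noteq> {}} \<and> (\<forall>u\<in>X. \<forall>v\<in>X. u \<noteq> v \<longrightarrow> supp u \<inter> supp v = {})}"
  have "\<exists>M\<in>?A. \<forall>X\<in>?A. M \<subseteq> X \<longrightarrow> X = M"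
  proof (rule subset_Zorn_nonempty)
    show "?A \<noteq> {}" by auto
  next
    fix \<C> assume C: "\<C> \<noteq> {}" "subset.chain ?A \<C>"
    have sub: "S \<subseteq> {v \<in> U. supp v \<noteq> {}}" "\<forall>u\<in>S. \<forall>v\<in>S. u \<noteq> v \<longrightarrow> supp u \<inter> supp v = {}"
      if "S \<in> \<C>" for S using C(2) that unfolding subset.chain_def by blast+
    have "supp u \<inter> supp v = {}" if uv: "u \<in> \<Union>\<C>" "v \<in> \<Union>\<C>" "u \<noteq> v" for u v
    proof -
      have "finite {u, v}" "{u, v} \<subseteq> \<Union>\<C>" using uv by auto
      then obtain S where "S \<in> \<C>" "{u, v} \<subseteq> S"
        using finite_subset_Union_chain[OF _ _ C, of "{u, v}"] by blast
      then show ?thesis using sub(2)[of S] uv(3) by blast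
    qed
    moreover have "\<Union>\<C> \<subseteq> {v \<in> U. supp v \<noteq> {}}" using sub(1) by blast
    ultimately show "\<Union>\<C> \<in> ?A" by blast
  qed
  then obtain M where MA: "M \<in> ?A" and max: "\<forall>X\<in>?A. M \<subseteq> X \<longrightarrow> X = M" by (rule bexE)
  have M: "M \<subseteq> {v \<in> U. supp v \<noteq> {}}"
      "\<And>u v. u \<in> M \<Longrightarrow> v \<in> M \<Longrightarrow> u \<noteq> v \<Longrightarrow> supp u \<inter> supp v = {}"
    using MA by simp_all
  have cM: "\<not> |M| \<le>o \<mu>"
  proof
    assume cM: "|M| \<le>o \<mu>"
    define V where "V = (\<Union>u\<in>M. supp u)"
    have V: "|V| \<le>o \<mu>" unfolding V_def
    proof (rule ordLeq_UN[OF \<mu> cM])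
      fix u assume "u \<in> M"
      then have "finite (supp u)" using M(1) U vecD(2) by blast
      then show "|supp u| \<le>o \<mu>" by (rule ordLess_imp_ordLeq[OF finite_ordLess_Cinfinite[OF \<mu>]])
    qed
    have hit: "supp u = {}" if u: "u \<in> U" "supp u \<inter> V = {}" for u
    proof (rule ccontr)
      assume ne: "supp u \<noteq> {}"
      have uM: "supp u \<inter> supp v = {}" if "v \<in> M" for v using u(2) that by (auto simp: V_def)
      then have "insert u M \<in> ?A" using M u(1) ne by (simp add: Int_commute)
      then have "insert u M = M" using max[THEN bspec, of "insert u M"] by blast
      then have "u \<in> M" by blast
      then show False using uM[of u] ne by simp
    qed
    \<comment> \<open>The graph of \<open>v\<close> on \<open>V\<close> without its zero values, a
      finite set that determines \<open>v\<close> on \<open>V\<close>.\<close>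
    define h where "h v = (\<lambda>x. (x, v x)) ` (V \<inter> supp v)" for v :: "'k set set \<Rightarrow> 'a"
    have "inj_on h U"
    proof (rule inj_onI)
      fix v w assume v: "v \<in> U" and w: "w \<in> U" and eq: "h v = h w"
      have vc: "v x \<in> carrier R" "w x \<in> carrier R" for x using v w U vecD(1) by blast+
      have "v x = w x" if x: "x \<in> V" for x
      proof (cases "v x = \<zero>")
        case True
        show ?thesis
        proof (rule ccontr)
          assume "v x \<noteq> w x"
          then have "(x, w x) \<in> h w" using True x by (auto simp: h_def supp_def)
          then have "(x, w x) \<in> h v" using eq by simp
          then have "w x = v x" by (auto simp: h_def)
          then show False using \<open>v x \<noteq> w x\<close> by simp
        qed
      next
        case False
        then have "(x, v x) \<in> h v" using x by (auto simp: h_def supp_def)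
        then have "(x, v x) \<in> h w" using eq by simp
        then show ?thesis by (auto simp: h_def)
      qed
      then have "supp (\<lambda>x. v x \<ominus> w x) \<inter> V = {}"
        using vc by (auto simp: supp_def)
      then have "supp (\<lambda>x. v x \<ominus> w x) = {}" by (rule hit[OF diff[OF v w]])
      then have "v x \<ominus> w x = \<zero>" for x by (auto simp: supp_def)
      then show "v = w" using vc by (intro ext) simp
    qed
    moreover have "h ` U \<subseteq> Fpow (V \<times> carrier R)"
    proof
      fix T assume "T \<in> h ` U"
      then obtain v where v: "v \<in> vec" "T = h v" using U by blast
      then show "T \<in> Fpow (V \<times> carrier R)"
        using vecD(1)[OF v(1)] vecD(2)[OF v(1)] by (auto simp: Fpow_def h_def)
    qed
    ultimately have "|U| \<le>o |Fpow (V \<times> carrier R)|"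
      using card_of_ordLeq[of U "Fpow (V \<times> carrier R)"] by blast
    then have "|U| \<le>o \<mu>"
      using ordLeq_Fpow[OF \<mu> ordLeq_Times[OF \<mu> V R]] by (rule ordLeq_transitive)
    then show False using card by simp
  qed
  \<comment> \<open>There are at most \<mu> finite sets of coefficients, so one class has more than
    \<mu> members.\<close>
  define MC where "MC C = {u \<in> M. u ` supp u = C}" for C
  have "M \<subseteq> (\<Union>C\<in>Fpow (carrier R). MC C)"
  proof
    fix u assume u: "u \<in> M"
    then have "u \<in> vec" using M(1) U by blast
    then have "u ` supp u \<in> Fpow (carrier R)" using vecD(1,2) by (auto simp: Fpow_def)
    then show "u \<in> (\<Union>C\<in>Fpow (carrier R). MC C)" using u by (auto simp: MC_def)
  qed
  then have "\<not> |\<Union>C\<in>Fpow (carrier R). MC C| \<le>o \<mu>" using cM ordLeq_subset[of _ \<mu> M] by blast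
  then obtain C where C: "C \<in> Fpow (carrier R)" "\<not> |MC C| \<le>o \<mu>"
    using ordLeq_UN[OF \<mu> ordLeq_Fpow[OF \<mu> R], of MC] by blast
  show thesis
  proof (rule that[of "MC C" "C - {\<zero>}"])
    show "MC C \<subseteq> U" using M(1) by (auto simp: MC_def)
    show "\<not> |MC C| \<le>o \<mu>" by (rule C(2))
    show "disjoint_family (MC C) (C - {\<zero>})"
      unfolding disjoint_family_def
    proof (intro conjI ballI impI)
      show "finite (C - {\<zero>})" "C - {\<zero>} \<subseteq> carrier R - {\<zero>}" using C(1) by (auto simp: Fpow_def)
    next
      fix u assume u: "u \<in> MC C"
      then have "u \<in> vec" "supp u \<noteq> {}" using M(1) U by (auto simp: MC_def)
      then show "finite (supp u)" "supp u \<noteq> {}" "supp u \<subseteq> Field r2" using vecD by auto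
      show "u \<in> supp u \<rightarrow> C - {\<zero>}" using u by (auto simp: MC_def supp_def)
    next
      fix u v assume "u \<in> MC C" "v \<in> MC C" "u \<noteq> v"
      then show "supp u \<inter> supp v = {}" using M(2)[of u v] by (simp add: MC_def)
    qed
  qed
qed

section \<open>The bilinear form of a matrix\<close>

definition form :: "('k set set \<Rightarrow> 'k set set \<Rightarrow> 'a) \<Rightarrow> ('k set set \<Rightarrow> 'a) \<Rightarrow> ('k set set \<Rightarrow> 'a) \<Rightarrow> 'a" where
  "form c u w = (\<Oplus>p\<in>supp u \<times> supp w. u (fst p) \<otimes> w (snd p) \<otimes> c (fst p) (snd p))"

text \<open>Enlarging the supports adds only zero terms. This provides a common index set when
  vectors with different supports are added.\<close>

lemma form_extend:
  assumes "u \<in> vec" "w \<in> vec" "\<And>x y. c x y \<in> carrier R"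
    "finite A" "finite B" "supp u \<subseteq> A" "supp w \<subseteq> B"
  shows "form c u w = (\<Oplus>p\<in>A \<times> B. u (fst p) \<otimes> w (snd p) \<otimes> c (fst p) (snd p))"
  unfolding form_def
proof (rule add.finprod_mono_neutral_cong_left)
  show "finite (A \<times> B)" "supp u \<times> supp w \<subseteq> A \<times> B" using assms(4-7) by auto
  show "(\<lambda>p. u (fst p) \<otimes> w (snd p) \<otimes> c (fst p) (snd p)) \<in> A \<times> B \<rightarrow> carrier R"
    using vecD(1)[OF assms(1)] vecD(1)[OF assms(2)] assms(3) by auto
  fix p assume "p \<in> A \<times> B - supp u \<times> supp w"
  then have "u (fst p) = \<zero> \<or> w (snd p) = \<zero>" by (auto simp: supp_def)
  then show "u (fst p) \<otimes> w (snd p) \<otimes> c (fst p) (snd p) = \<zero>"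
    using vecD(1)[OF assms(1)] vecD(1)[OF assms(2)] assms(3) by auto
qed simp

lemma form_closed:
  assumes "u \<in> vec" "w \<in> vec" "\<And>x y. c x y \<in> carrier R"
  shows "form c u w \<in> carrier R"
  unfolding form_def using vecD(1)[OF assms(1)] vecD(1)[OF assms(2)] assms(3)
  by (intro finsum_closed) auto

lemma form_sym:
  assumes "u \<in> vec" "w \<in> vec" "\<And>x y. c x y \<in> carrier R" "\<And>x y. c x y = c y x"
  shows "form c u w = form c w u"
proof -
  have uc: "u x \<in> carrier R" "w x \<in> carrier R" for x using vecD(1) assms(1,2) by auto
  have "form c w u = (\<Oplus>p\<in>prod.swap ` (supp u \<times> supp w). w (fst p) \<otimes> u (snd p) \<otimes> c (fst p) (snd p))"
    unfolding form_def by (simp add: product_swap)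
  also have "\<dots> = (\<Oplus>p\<in>supp u \<times> supp w. w (fst (prod.swap p)) \<otimes> u (snd (prod.swap p)) \<otimes> c (fst (prod.swap p)) (snd (prod.swap p)))"
    using uc assms(3) by (intro finsum_reindex) auto
  also have "\<dots> = form c u w" unfolding form_def
    using uc assms(3) by (intro finsum_cong') (auto simp: m_comm assms(4))
  finally show ?thesis by simp
qed

lemma vec_add: "u \<in> vec \<Longrightarrow> v \<in> vec \<Longrightarrow> (\<lambda>x. u x \<oplus> v x) \<in> vec"
proof -
  assume u: "u \<in> vec" and v: "v \<in> vec"
  have "supp (\<lambda>x. u x \<oplus> v x) \<subseteq> supp u \<union> supp v" by (auto simp: supp_def)
  then show ?thesis
    using u v finite_subset[of "supp (\<lambda>x. u x \<oplus> v x)" "supp u \<union> supp v"] by (auto simp: vec_def)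
qed

lemma vec_smult: "k \<in> carrier R \<Longrightarrow> v \<in> vec \<Longrightarrow> (\<lambda>x. k \<otimes> v x) \<in> vec"
proof -
  assume k: "k \<in> carrier R" and v: "v \<in> vec"
  have "supp (\<lambda>x. k \<otimes> v x) \<subseteq> supp v" using k by (auto simp: supp_def)
  then show ?thesis
    using k v finite_subset[of "supp (\<lambda>x. k \<otimes> v x)" "supp v"] by (auto simp: vec_def)
qed

lemma vec_zero: "(\<lambda>x. \<zero>) \<in> vec"
  by (simp add: vec_def supp_def)

lemma form_add_left:
  assumes "u \<in> vec" "v \<in> vec" "w \<in> vec" "\<And>x y. c x y \<in> carrier R"
  shows "form c (\<lambda>x. u x \<oplus> v x) w = form c u w \<oplus> form c v w"
proof -
  let ?A = "supp u \<union> supp v"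
  have fin: "finite ?A" "finite (supp w)" using assms(1-3) vecD(2) by auto
  have uc: "u x \<in> carrier R" "v x \<in> carrier R" "w x \<in> carrier R" for x using vecD(1) assms(1-3) by auto
  have "form c (\<lambda>x. u x \<oplus> v x) w
      = (\<Oplus>p\<in>?A \<times> supp w. (u (fst p) \<oplus> v (fst p)) \<otimes> w (snd p) \<otimes> c (fst p) (snd p))"
    using fin by (intro form_extend vec_add assms) (auto simp: supp_def)
  also have "\<dots> = (\<Oplus>p\<in>?A \<times> supp w. u (fst p) \<otimes> w (snd p) \<otimes> c (fst p) (snd p)
      \<oplus> v (fst p) \<otimes> w (snd p) \<otimes> c (fst p) (snd p))"
    using uc assms(4) by (intro finsum_cong') (auto simp: l_distr)
  also have "\<dots> = (\<Oplus>p\<in>?A \<times> supp w. u (fst p) \<otimes> w (snd p) \<otimes> c (fst p) (snd p))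
      \<oplus> (\<Oplus>p\<in>?A \<times> supp w. v (fst p) \<otimes> w (snd p) \<otimes> c (fst p) (snd p))"
    using uc assms(4) by (intro finsum_addf) auto
  also have "\<dots> = form c u w \<oplus> form c v w"
    using form_extend[OF assms(1,3,4) fin] form_extend[OF assms(2,3,4) fin] by simp
  finally show ?thesis .
qed

lemma form_smult_left:
  assumes "k \<in> carrier R" "u \<in> vec" "w \<in> vec" "\<And>x y. c x y \<in> carrier R"
  shows "form c (\<lambda>x. k \<otimes> u x) w = k \<otimes> form c u w"
proof -
  have fin: "finite (supp u)" "finite (supp w)" using assms(2,3) vecD(2) by auto
  have uc: "u x \<in> carrier R" "w x \<in> carrier R" for x using vecD(1) assms(2,3) by auto
  have "form c (\<lambda>x. k \<otimes> u x) w
      = (\<Oplus>p\<in>supp u \<times> supp w. (k \<otimes> u (fst p)) \<otimes> w (snd p) \<otimes> c (fst p) (snd p))"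
    using fin assms(1) by (intro form_extend vec_smult assms) (auto simp: supp_def)
  also have "\<dots> = (\<Oplus>p\<in>supp u \<times> supp w. k \<otimes> (u (fst p) \<otimes> w (snd p) \<otimes> c (fst p) (snd p)))"
    using uc assms(1,4) by (intro finsum_cong') (auto simp: m_assoc)
  also have "\<dots> = k \<otimes> form c u w"
    unfolding form_def using uc assms(1,4) fin by (intro finsum_rdistr[symmetric]) auto
  finally show ?thesis .
qed

lemma form_zero_left: "form c (\<lambda>x. \<zero>) w = \<zero>"
  by (simp add: form_def supp_def)

text \<open>The part of \<open>c\<close> with increasing indices is mirrored; the diagonal value
  zero is an arbitrary choice.\<close>

definition sym_coeff :: "('k set set \<Rightarrow> 'k set set \<Rightarrow> 'a) \<Rightarrow> 'k set set \<Rightarrow> 'k set set \<Rightarrow> 'a" where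
  "sym_coeff c x y = (if x \<prec>\<^sub>2 y then c x y else if y \<prec>\<^sub>2 x then c y x else \<zero>)"

lemma not_both_less2: "x \<prec>\<^sub>2 y \<Longrightarrow> \<not> y \<prec>\<^sub>2 x"
  using underS_trans[OF wo2, of x y x] by (auto simp: underS_notIn)

lemma sym_coeff_commute: "sym_coeff c x y = sym_coeff c y x"
  using not_both_less2 by (auto simp: sym_coeff_def)

text \<open>If both groups were large, they would contain large disjoint families. These are thinned
  until all supports of the first lie below some \<open>d\<close> and all supports of the second
  above it; \<open>gross_coefficients\<close> then yields a nonorthogonal pair.\<close>

lemma card_orthogonal:
  assumes c: "gross_coefficients c"
    and U: "U \<subseteq> vec" "\<And>v w. v \<in> U \<Longrightarrow> w \<in> U \<Longrightarrow> (\<lambda>x. v x \<ominus> w x) \<in> U"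
    and W: "W \<subseteq> vec" "\<And>v w. v \<in> W \<Longrightarrow> w \<in> W \<Longrightarrow> (\<lambda>x. v x \<ominus> w x) \<in> W"
    and orth: "\<And>u w. u \<in> U \<Longrightarrow> w \<in> W \<Longrightarrow> form (sym_coeff c) u w = \<zero>"
    and cU: "\<not> |U| \<le>o \<kappa>"
  shows "|W| \<le>o r1"
proof (rule ccontr)
  assume cW: "\<not> |W| \<le>o r1"
  have R: "|carrier R| \<le>o \<kappa>" by (rule ordIso_imp_ordLeq[OF card_carrier])
  obtain X C where X: "X \<subseteq> U" "disjoint_family X C" "\<not> |X| \<le>o \<kappa>"
    by (rule extract_disjoint_family[OF U kappa R cU])
  obtain Y D where Y: "Y \<subseteq> W" "disjoint_family Y D" "\<not> |Y| \<le>o r1"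
    by (rule extract_disjoint_family[OF W r1 kappa_le_r1[OF R] cW])
  have "r1 \<le>o |X|" using cardSuc_ordLeq_iff[OF Card_kappa] X(3) by blast
  \<comment> \<open>With exactly \<open>r1\<close> many members the union of the supports has size
    at most \<open>r1\<close>, hence is bounded in \<open>r2\<close>.\<close>
  then obtain X' where X': "X' \<subseteq> X" "|X'| =o r1" using exists_subset_ordIso[OF Card_r1] by blast
  note XD = disjoint_family_mono[OF X(2) X'(1)]
  have "\<not> |X'| \<le>o \<kappa>"
    using cardSuc_ordLeq_iff[OF Card_kappa, of X'] ordIso_imp_ordLeq[OF ordIso_symmetric[OF X'(2)]]
    by simp
  define A where "A = (\<Union>u\<in>X'. supp u)"
  have AF: "A \<subseteq> Field r2" using XD unfolding A_def disjoint_family_def by blast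
  have "|A| \<le>o r1" unfolding A_def
  proof (rule ordLeq_UN[OF r1 ordIso_imp_ordLeq[OF X'(2)]])
    fix u assume "u \<in> X'"
    then have "finite (supp u)" using XD by (simp add: disjoint_family_def)
    then show "|supp u| \<le>o r1" by (rule ordLess_imp_ordLeq[OF finite_ordLess_Cinfinite[OF r1]])
  qed
  then obtain d where d: "d \<in> Field r2" "A \<subseteq> underS r2 d"
    using ex_above_underS[OF r1 AF] by blast
  \<comment> \<open>At most \<open>r1\<close> members meet the segment up to \<open>d\<close>; all
    the others lie entirely above \<open>d\<close>.\<close>
  define Y' where "Y' = {w \<in> Y. supp w \<inter> insert d (underS r2 d) = {}}"
  have cY': "\<not> |Y'| \<le>o r1"
    unfolding Y'_def by (rule family_avoiding[OF Y(2) r1 Y(3) card_insert_underS2])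
  have YD: "disjoint_family Y' D"
    by (rule disjoint_family_mono[OF Y(2)]) (auto simp: Y'_def)
  have Yd: "d \<prec>\<^sub>2 y" if "w \<in> Y'" "y \<in> supp w" for w y
  proof -
    have "y \<in> Field r2" using YD that by (auto simp: disjoint_family_def)
    then show ?thesis using underS_linear[OF wo2 d(1), of y] that by (auto simp: Y'_def)
  qed
  have Xd: "x \<prec>\<^sub>2 d" if "u \<in> X'" "x \<in> supp u" for u x using d(2) that by (auto simp: A_def)
  have "\<exists>u\<in>X'. \<exists>w\<in>Y'. (\<Oplus>p\<in>supp u \<times> supp w. u (fst p) \<otimes> w (snd p) \<otimes> c (fst p) (snd p)) \<noteq> \<zero>"
    using c[unfolded gross_coefficients_def, THEN conjunct2, rule_format,
      OF XD YD \<open>\<not> |X'| \<le>o \<kappa>\<close> cY' d(1) Xd Yd] by simp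
  then obtain u w where uw: "u \<in> X'" "w \<in> Y'"
    "(\<Oplus>p\<in>supp u \<times> supp w. u (fst p) \<otimes> w (snd p) \<otimes> c (fst p) (snd p)) \<noteq> \<zero>" by blast
  have uU: "u \<in> U" "w \<in> W" using uw X' X(1) Y(1) by (auto simp: Y'_def)
  then have uv: "u \<in> vec" "w \<in> vec" using U(1) W(1) by auto
  have cc: "c x y \<in> carrier R" for x y using c by (simp add: gross_coefficients_def)
  have "form (sym_coeff c) u w = (\<Oplus>p\<in>supp u \<times> supp w. u (fst p) \<otimes> w (snd p) \<otimes> c (fst p) (snd p))"
    unfolding form_def
  proof (rule finsum_cong')
    fix p assume "p \<in> supp u \<times> supp w"
    then have "fst p \<prec>\<^sub>2 snd p"
      using underS_trans[OF wo2 Xd[OF uw(1)] Yd[OF uw(2)], of "fst p" "snd p"] by auto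
    then show "u (fst p) \<otimes> w (snd p) \<otimes> sym_coeff c (fst p) (snd p) = u (fst p) \<otimes> w (snd p) \<otimes> c (fst p) (snd p)"
      by (simp add: sym_coeff_def)
  qed (use vecD(1)[OF uv(1)] vecD(1)[OF uv(2)] cc in auto)
  then show False using orth[OF uU] uw(3) by simp
qed

section \<open>Counting vectors and transporting the form\<close>

lemma card_vec: "|vec| =o r2"
proof (rule ordIso_iff_ordLeq[THEN iffD2], rule conjI)
  have F2: "|Field r2| \<le>o r2" by (rule ordIso_imp_ordLeq[OF card_of_Field_ordIso[OF Card_r2]])
  have R: "|carrier R| \<le>o r2"
    using kappa_le_r1[OF ordIso_imp_ordLeq[OF card_carrier]] cardSuc_ordLeq[OF Card_r1]
    by (rule ordLeq_transitive)
  define h where "h v = (\<lambda>x. (x, v x)) ` supp v" for v :: "'k set set \<Rightarrow> 'a"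
  have "inj_on h vec"
  proof (rule inj_onI, rule ext)
    fix v w x assume eq: "h v = h w"
    show "v x = w x"
    proof (cases "x \<in> supp v \<or> x \<in> supp w")
      case True
      then have "(x, v x) \<in> h v \<or> (x, w x) \<in> h w" by (auto simp: h_def)
      then have "(x, v x) \<in> h w \<or> (x, w x) \<in> h v" using eq by simp
      then show ?thesis by (auto simp: h_def)
    qed (auto simp: supp_def)
  qed
  moreover have "h ` vec \<subseteq> Fpow (Field r2 \<times> carrier R)"
    by (auto simp: h_def vec_def Fpow_def)
  ultimately have "|vec| \<le>o |Fpow (Field r2 \<times> carrier R)|"
    using card_of_ordLeq[of vec "Fpow (Field r2 \<times> carrier R)"] by blast
  then show "|vec| \<le>o r2"
    using ordLeq_Fpow[OF r2 ordLeq_Times[OF r2 F2 R]] by (rule ordLeq_transitive)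
next
  define e where "e x = (\<lambda>y. if y = x then \<one> else \<zero>)" for x :: "'k set set"
  have "inj_on e (Field r2)"
  proof (rule inj_onI, rule ccontr)
    fix x y assume "e x = e y" "x \<noteq> y"
    then have "e x x = e y x" "x \<noteq> y" by auto
    then show False by (simp add: e_def)
  qed
  moreover have "e ` Field r2 \<subseteq> vec"
  proof (rule image_subsetI)
    fix x assume "x \<in> Field r2"
    moreover have "supp (e x) = {x}" by (auto simp: supp_def e_def)
    ultimately show "e x \<in> vec" by (simp add: vec_def) (simp add: e_def)
  qed
  ultimately have "|Field r2| \<le>o |vec|" using card_of_ordLeq[of "Field r2" vec] by blast
  with ordIso_symmetric[OF card_of_Field_ordIso[OF Card_r2]] show "r2 \<le>o |vec|"
    by (rule ordIso_ordLeq_trans)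
qed

end

text \<open>Dimensions are estimated by counting vectors. A subspace of dimension at least
  \<open>r1\<close> has more than \<kappa> vectors, so by \<open>card_orthogonal\<close> its
  orthogonal space has at most \<open>r1\<close> vectors and hence dimension below
  \<open>r2\<close>.\<close>

lemma (in infinite_field) exists_gross_space:
  "\<exists>(E :: ('a, 'k set set) module) \<Phi>. gross_space r1 R E \<Phi> \<and> vectorspace.cdim R E =o r2"
proof -
  obtain c where c: "gross_coefficients c" using exists_gross_coefficients by blast
  define cs where "cs = sym_coeff c"
  have csc: "cs x y \<in> carrier R" for x y
    using c by (auto simp: cs_def sym_coeff_def gross_coefficients_def)
  have cscomm: "cs x y = cs y x" for x y unfolding cs_def by (rule sym_coeff_commute)
  have F2: "|Field r2| =o r2" by (rule card_of_Field_ordIso[OF Card_r2])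
  have "|Field r2| =o |vec|" using F2 ordIso_symmetric[OF card_vec] by (rule ordIso_transitive)
  \<comment> \<open>Transport along this bijection replaces functions by elements of type
    \<open>'k set set\<close>, the type of vectors in the statement.\<close>
  then obtain dec where dec: "bij_betw dec (Field r2) vec"
    using card_of_ordIso[of "Field r2" vec] by auto
  define enc where "enc = inv_into (Field r2) dec"
  have decv: "dec x \<in> vec" if "x \<in> Field r2" for x using dec that by (auto simp: bij_betw_def)
  have decinj: "x = y" if "x \<in> Field r2" "y \<in> Field r2" "dec x = dec y" for x y
    using dec that by (auto simp: bij_betw_def inj_on_def)
  have enc: "enc v \<in> Field r2" "dec (enc v) = v" if "v \<in> vec" for v
    using dec that unfolding enc_def bij_betw_def by (auto intro: inv_into_into f_inv_into_f)
  \<comment> \<open>vectors are coded by the elements of \<open>Field r2\<close>, which also index the basis\<close>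
  define E :: "('a, 'k set set) module" where
    "E = \<lparr>carrier = Field r2, mult = undefined, one = undefined, ring.zero = enc (\<lambda>_. \<zero>),
      add = \<lambda>x y. enc (\<lambda>i. dec x i \<oplus> dec y i), smult = \<lambda>k x. enc (\<lambda>i. k \<otimes> dec x i)\<rparr>"
  have carE: "carrier E = Field r2" by (simp add: E_def)
  have zeroE: "\<zero>\<^bsub>E\<^esub> \<in> Field r2" "dec \<zero>\<^bsub>E\<^esub> = (\<lambda>_. \<zero>)"
    using enc[OF vec_zero] by (simp_all add: E_def)
  have addE: "x \<oplus>\<^bsub>E\<^esub> y \<in> Field r2" "dec (x \<oplus>\<^bsub>E\<^esub> y) = (\<lambda>i. dec x i \<oplus> dec y i)"
    if "x \<in> Field r2" "y \<in> Field r2" for x y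
    using enc[OF vec_add[OF decv decv]] that by (simp_all add: E_def)
  have smultE: "k \<odot>\<^bsub>E\<^esub> x \<in> Field r2" "dec (k \<odot>\<^bsub>E\<^esub> x) = (\<lambda>i. k \<otimes> dec x i)"
    if "k \<in> carrier R" "x \<in> Field r2" for k x
    using enc[OF vec_smult[OF that(1) decv]] that by (simp_all add: E_def)
  have dc: "dec x i \<in> carrier R" if "x \<in> Field r2" for x i using vecD(1)[OF decv[OF that]] .
  note ops = zeroE addE smultE dc
  have "vectorspace R E"
  proof (rule vs_criteria, unfold carE)
    show "field R" by (rule field_axioms)
    show "\<forall>v\<in>Field r2. \<exists>w\<in>Field r2. v \<oplus>\<^bsub>E\<^esub> w = \<zero>\<^bsub>E\<^esub>"
    proof
      fix v assume v: "v \<in> Field r2"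
      have "v \<oplus>\<^bsub>E\<^esub> (\<ominus> \<one>) \<odot>\<^bsub>E\<^esub> v = \<zero>\<^bsub>E\<^esub>"
        using v by (intro decinj) (simp_all add: ops l_minus r_neg)
      then show "\<exists>w\<in>Field r2. v \<oplus>\<^bsub>E\<^esub> w = \<zero>\<^bsub>E\<^esub>"
        using v smultE(1)[of "\<ominus> \<one>" v] by auto
    qed
    show "\<forall>v w. v \<in> Field r2 \<and> w \<in> Field r2 \<longrightarrow> v \<oplus>\<^bsub>E\<^esub> w = w \<oplus>\<^bsub>E\<^esub> v"
      by (intro allI impI decinj) (auto simp: ops a_comm)
    show "\<forall>v w x. v \<in> Field r2 \<and> w \<in> Field r2 \<and> x \<in> Field r2 \<longrightarrow> v \<oplus>\<^bsub>E\<^esub> w \<oplus>\<^bsub>E\<^esub> x = v \<oplus>\<^bsub>E\<^esub> (w \<oplus>\<^bsub>E\<^esub> x)"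
      by (intro allI impI decinj) (auto simp: ops a_assoc)
    show "\<forall>v\<in>Field r2. v \<oplus>\<^bsub>E\<^esub> \<zero>\<^bsub>E\<^esub> = v"
      by (intro ballI decinj) (auto simp: ops)
    show "\<forall>a b v. a \<in> carrier R \<and> b \<in> carrier R \<and> v \<in> Field r2 \<longrightarrow> a \<otimes> b \<odot>\<^bsub>E\<^esub> v = a \<odot>\<^bsub>E\<^esub> (b \<odot>\<^bsub>E\<^esub> v)"
      by (intro allI impI decinj) (auto simp: ops m_assoc)
    show "\<forall>v\<in>Field r2. \<one> \<odot>\<^bsub>E\<^esub> v = v"
      by (intro ballI decinj) (auto simp: ops)
    show "\<forall>a b v. a \<in> carrier R \<and> b \<in> carrier R \<and> v \<in> Field r2 \<longrightarrow>
        (a \<oplus> b) \<odot>\<^bsub>E\<^esub> v = a \<odot>\<^bsub>E\<^esub> v \<oplus>\<^bsub>E\<^esub> b \<odot>\<^bsub>E\<^esub> v"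
      by (intro allI impI decinj) (auto simp: ops l_distr)
    show "\<forall>a v w. a \<in> carrier R \<and> v \<in> Field r2 \<and> w \<in> Field r2 \<longrightarrow>
        a \<odot>\<^bsub>E\<^esub> (v \<oplus>\<^bsub>E\<^esub> w) = a \<odot>\<^bsub>E\<^esub> v \<oplus>\<^bsub>E\<^esub> a \<odot>\<^bsub>E\<^esub> w"
      by (intro allI impI decinj) (auto simp: ops r_distr)
  qed (auto simp: ops)
  then interpret E: vectorspace R E .
  define \<Phi> where "\<Phi> x y = form cs (dec x) (dec y)" for x y
  have sym: "\<Phi> x y = \<Phi> y x" if "x \<in> Field r2" "y \<in> Field r2" for x y
    unfolding \<Phi>_def using that by (intro form_sym decv csc cscomm)
  have add: "\<Phi> (x \<oplus>\<^bsub>E\<^esub> y) z = \<Phi> x z \<oplus> \<Phi> y z"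
    if "x \<in> Field r2" "y \<in> Field r2" "z \<in> Field r2" for x y z
    unfolding \<Phi>_def addE(2)[OF that(1,2)] using that by (intro form_add_left decv csc)
  have smult: "\<Phi> (k \<odot>\<^bsub>E\<^esub> x) y = k \<otimes> \<Phi> x y"
    if "k \<in> carrier R" "x \<in> Field r2" "y \<in> Field r2" for k x y
    unfolding \<Phi>_def smultE(2)[OF that(1,2)] using that by (intro form_smult_left decv csc)
  have zero: "\<Phi> \<zero>\<^bsub>E\<^esub> y = \<zero>" for y
    unfolding \<Phi>_def zeroE(2) by (rule form_zero_left)
  have "symmetric_bilinear_space R E \<Phi>"
  proof (unfold_locales, unfold carE)
    fix x y assume "x \<in> Field r2" "y \<in> Field r2"
    then show "\<Phi> x y \<in> carrier R" unfolding \<Phi>_def by (intro form_closed decv csc)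
  next
    fix x y z assume xyz: "x \<in> Field r2" "y \<in> Field r2" "z \<in> Field r2"
    then show "\<Phi> (x \<oplus>\<^bsub>E\<^esub> y) z = \<Phi> x z \<oplus> \<Phi> y z" by (rule add)
    show "\<Phi> x (y \<oplus>\<^bsub>E\<^esub> z) = \<Phi> x y \<oplus> \<Phi> x z"
      using add[OF xyz(2,3,1)] sym[OF xyz(1) addE(1)[OF xyz(2,3)]] sym[OF xyz(1,2)] sym[OF xyz(1,3)]
      by simp
  next
    fix k x y assume kxy: "k \<in> carrier R" "x \<in> Field r2" "y \<in> Field r2"
    then show "\<Phi> (k \<odot>\<^bsub>E\<^esub> x) y = k \<otimes> \<Phi> x y" by (rule smult)
    show "\<Phi> x (k \<odot>\<^bsub>E\<^esub> y) = k \<otimes> \<Phi> x y"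
      using smult[OF kxy(1,3,2)] sym[OF kxy(2) smultE(1)[OF kxy(1,3)]] sym[OF kxy(2,3)] by simp
  next
    fix x y assume "x \<in> Field r2" "y \<in> Field r2"
    then show "\<Phi> x y = \<Phi> y x" by (rule sym)
  qed
  then interpret S: symmetric_bilinear_space R E \<Phi> .
  have R: "|carrier R| \<le>o r1" by (rule kappa_le_r1[OF ordIso_imp_ordLeq[OF card_carrier]])
  have dimE: "E.cdim =o r2"
  proof (rule ordIso_iff_ordLeq[THEN iffD2], rule conjI)
    show "E.cdim \<le>o r2"
      using E.cdim_ordLeq_carrier[unfolded carE] ordIso_imp_ordLeq[OF F2] by (rule ordLeq_transitive)
    obtain B where B: "E.basis B" "E.cdim = |B|" by (rule E.cdim_basis)
    \<comment> \<open>With dimension at most \<open>r1\<close> over a field of size \<kappa> there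
      would be at most \<open>r1\<close> vectors, but there are \<open>r2\<close>.\<close>
    have "\<not> E.cdim \<le>o r1"
    proof
      assume "E.cdim \<le>o r1"
      from E.carrier_ordLeq[OF r1 R this] have "|Field r2| \<le>o r1" by (simp add: carE)
      then have "|Field r2| <o r2" by (rule ordLess_cardSuc_iff[OF Card_r1, THEN iffD2])
      then show False using F2 not_ordLess_ordIso[of "|Field r2|" r2] by simp
    qed
    then show "r2 \<le>o E.cdim" using cardSuc_ordLeq_iff[OF Card_r1, of B] by (simp add: B(2))
  qed
  have diff_image: "(\<lambda>i. v i \<ominus> w i) \<in> dec ` U"
    if U: "submodule R U E" and "v \<in> dec ` U" "w \<in> dec ` U" for U v w
  proof -
    obtain x y where x: "x \<in> U" and y: "y \<in> U" and vw: "v = dec x" "w = dec y"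
      using \<open>v \<in> dec ` U\<close> \<open>w \<in> dec ` U\<close> by (elim imageE)
    have F: "x \<in> Field r2" "y \<in> Field r2" using submodule.subset[OF U] x y by (auto simp: carE)
    have "(\<ominus> \<one>) \<odot>\<^bsub>E\<^esub> y \<in> U" using submodule.smult_closed[OF U _ y] by simp
    then have "x \<oplus>\<^bsub>E\<^esub> (\<ominus> \<one>) \<odot>\<^bsub>E\<^esub> y \<in> U" by (rule submodule.m_closed[OF U x])
    moreover have "dec (x \<oplus>\<^bsub>E\<^esub> (\<ominus> \<one>) \<odot>\<^bsub>E\<^esub> y) = (\<lambda>i. dec x i \<ominus> dec y i)"
      using F by (simp add: ops l_minus a_minus_def)
    ultimately show ?thesis unfolding vw by (intro image_eqI) simp_all
  qed
  have orthF: "S.orth U \<subseteq> Field r2" for U by (auto simp: S.orth_def carE)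
  have orth: "submodule R (S.orth U) E" if U: "U \<subseteq> Field r2" for U
  proof (unfold_locales, unfold carE)
    show "S.orth U \<subseteq> Field r2" by (rule orthF)
    show "\<zero>\<^bsub>E\<^esub> \<in> S.orth U" by (simp add: S.orth_def carE zeroE zero)
  next
    fix v w assume "v \<in> S.orth U" "w \<in> S.orth U"
    then show "v \<oplus>\<^bsub>E\<^esub> w \<in> S.orth U"
      using U by (auto simp: S.orth_def carE addE add subset_iff)
  next
    fix k v assume "k \<in> carrier R" "v \<in> S.orth U"
    then show "k \<odot>\<^bsub>E\<^esub> v \<in> S.orth U"
      using U by (auto simp: S.orth_def carE smultE smult subset_iff)
  qed
  have "gross_space r1 R E \<Phi>"
  proof (unfold_locales)
    show "Cinfinite r1" by (rule r1)
    fix U assume U: "subspace R U E" and dim: "r1 \<le>o vectorspace.cdim R (E.vs U)"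
    have sub: "submodule R U E" using U by (simp add: subspace_def)
    have UF: "U \<subseteq> Field r2" using submodule.subset[OF sub] by (simp add: carE)
    have sub': "submodule R (S.orth U) E" by (rule orth[OF UF])
    have vsU: "vectorspace R (E.vs U)" by (rule E.subspace_is_vs[OF U])
    have vsO: "vectorspace R (E.vs (S.orth U))"
      by (rule E.subspace_is_vs) (simp add: subspace_def sub' E.vectorspace_axioms)
    have "vectorspace.cdim R (E.vs U) \<le>o |U|"
      using vectorspace.cdim_ordLeq_carrier[OF vsU] by simp
    with dim have "r1 \<le>o |U|" by (rule ordLeq_transitive)
    then have cU: "\<not> |U| \<le>o \<kappa>" by (rule cardSuc_ordLeq_iff[OF Card_kappa, THEN iffD1])
    have card_dec: "|A| \<le>o |dec ` A|" if "A \<subseteq> Field r2" for A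
    proof -
      have "inj_on dec A" using dec that by (meson bij_betw_def inj_on_subset)
      then show ?thesis using card_of_ordLeq[of A "dec ` A"] by blast
    qed
    have "|dec ` S.orth U| \<le>o r1"
    proof (rule card_orthogonal[OF c])
      show "dec ` U \<subseteq> vec" "dec ` S.orth U \<subseteq> vec" using UF orthF decv by blast+
      show "\<not> |dec ` U| \<le>o \<kappa>" using card_dec[OF UF] cU ordLeq_transitive[of "|U|" "|dec ` U|" \<kappa>] by blast
    next
      fix v w assume "v \<in> dec ` U" "w \<in> dec ` U"
      then show "(\<lambda>x. v x \<ominus> w x) \<in> dec ` U" by (rule diff_image[OF sub])
    next
      fix v w assume "v \<in> dec ` S.orth U" "w \<in> dec ` S.orth U"
      then show "(\<lambda>x. v x \<ominus> w x) \<in> dec ` S.orth U" by (rule diff_image[OF sub'])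
    next
      fix u w assume "u \<in> dec ` U" "w \<in> dec ` S.orth U"
      then obtain x y where xy: "x \<in> U" "u = dec x" "y \<in> S.orth U" "w = dec y" by blast
      then have "\<Phi> y x = \<zero>" "x \<in> Field r2" "y \<in> Field r2" using UF by (auto simp: S.orth_def carE)
      then show "form (sym_coeff c) u w = \<zero>"
        using sym[of x y] xy(2,4) by (simp add: \<Phi>_def cs_def)
    qed
    with card_dec[OF orthF] have "|S.orth U| \<le>o r1" by (rule ordLeq_transitive)
    moreover have "vectorspace.cdim R (E.vs (S.orth U)) \<le>o |S.orth U|"
      using vectorspace.cdim_ordLeq_carrier[OF vsO] by simp
    ultimately have "vectorspace.cdim R (E.vs (S.orth U)) \<le>o r1" by (rule ordLeq_transitive[rotated])
    then have "vectorspace.cdim R (E.vs (S.orth U)) <o r2"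
      using cardSuc_greater[OF Card_r1] by (rule ordLeq_ordLess_trans)
    then show "vectorspace.cdim R (E.vs (S.orth U)) <o E.cdim"
      using ordIso_symmetric[OF dimE] by (rule ordLess_ordIso_trans)
  qed
  then show ?thesis using dimE by blast
qed

theorem theorem6:
  fixes \<kappa> :: "'k rel" and F :: "('a, 'm) ring_scheme"
  assumes "Cinfinite \<kappa>"
    and "field F"
    and "|carrier F| =o \<kappa>"
  shows "\<exists>(E :: ('a, 'k set set) module) \<Phi>.
    gross_space (cardSuc \<kappa>) F E \<Phi> \<and> vectorspace.cdim F E =o cardSuc (cardSuc \<kappa>)"
proof -
  interpret field F by (rule assms(2))
  interpret infinite_field \<kappa> F by unfold_locales (fact assms)+
  show ?thesis by (rule exists_gross_space)
qed

end
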